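(* For every $\alpha\in[1/2,3/4]$, \[ \dim_{\mathcal{H}}\phi(D_{\alpha}) \leq \dim_{\mathcal{H}}\bigcup_{\beta \leq \alpha}\phi(D_{\beta}) \leq \frac{4\alpha - 2}{\alpha}. \]
   Context: $\phi(t) = \sum_{k \in \mathbb{Z}} \frac{ e^{-4\pi^2 i k^2 t} - 1 }{-4\pi^2 k^2}$ for $t\in\mathbb{R}$, where the $k=0$ term is interpreted as its limit value $it$. For $\alpha>0$ and $x_0\in\mathbb{R}$, we write $\phi\in C^\alpha(x_0)$ if there exist a polynomial $P$ (with complex coefficients) of degree at most $\alpha$ and a constant $C>0$ such that $|\phi(x_0+h)-P(h)|\leq C|h|^\alpha$ for all sufficiently small $|h|$. The Hölder exponent of $\phi$ at $x_0$ is $\alpha(x_0)=\sup\{\alpha : \phi\in C^\alpha(x_0)\}$, and for $\beta\in\mathbb{R}$, $D_\beta=\{x\in\mathbb{R} : \alpha(x)=\beta\}$. $\dim_{\mathcal{H}}$ denotes Hausdorff dimension. *)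

theory Defs
  imports "HOL-Analysis.Analysis" "HOL-Computational_Algebra.Polynomial"
begin

text \<open>The function phi(t) = sum over k in Z of (exp(-4 pi^2 i k^2 t) - 1)/(-4 pi^2 k^2),
  the k = 0 term being its limit value i t.\<close>
definition phi_term :: "real \<Rightarrow> int \<Rightarrow> complex" where
  "phi_term t k = (if k = 0 then \<i> * complex_of_real t
     else (exp (- (4 * complex_of_real (pi^2) * \<i> * of_int (k^2) * complex_of_real t)) - 1)
          / (- 4 * complex_of_real (pi^2) * of_int (k^2)))"

definition phi :: "real \<Rightarrow> complex" where
  "phi t = (\<Sum>\<^sub>\<infinity>k::int. phi_term t k)"

definition holder_at :: "(real \<Rightarrow> complex) \<Rightarrow> real \<Rightarrow> real \<Rightarrow> bool" where
  "holder_at f \<alpha> x0 \<longleftrightarrow> \<alpha> > 0 \<and>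
     (\<exists>P :: complex poly. real (degree P) \<le> \<alpha> \<and>
        (\<exists>C > 0. \<forall>\<^sub>F h in nhds 0.
            norm (f (x0 + h) - poly P (complex_of_real h)) \<le> C * \<bar>h\<bar> powr \<alpha>))"

text \<open>Hoelder exponent (as an extended real, sup of the empty set being -infinity).\<close>
definition holder_exponent :: "(real \<Rightarrow> complex) \<Rightarrow> real \<Rightarrow> ereal" where
  "holder_exponent f x0 = Sup {ereal \<alpha> | \<alpha>. holder_at f \<alpha> x0}"

definition D_set :: "real \<Rightarrow> real set" where
  "D_set \<beta> = {x. holder_exponent phi x = ereal \<beta>}"

definition hausdorff_pre :: "real \<Rightarrow> real \<Rightarrow> 'a::metric_space set \<Rightarrow> ennreal" where
  "hausdorff_pre s \<delta> A =
     (INF U \<in> {U :: nat \<Rightarrow> 'a set. A \<subseteq> (\<Union>i. U i) \<and> (\<forall>i. bounded (U i) \<and> diameter (U i) \<le> \<delta>)}.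
        (\<Sum>i. ennreal (diameter (U i) powr s)))"

definition hausdorff_measure :: "real \<Rightarrow> 'a::metric_space set \<Rightarrow> ennreal" where
  "hausdorff_measure s A = (SUP \<delta> \<in> {0<..}. hausdorff_pre s \<delta> A)"

definition hausdorff_dim :: "'a::metric_space set \<Rightarrow> ereal" where
  "hausdorff_dim A = Inf {ereal s | s. s > 0 \<and> hausdorff_measure s A = 0}"

end

theory Submission
  imports Defs
begin

text \<open>
  In the variable \<open>x = - 2 \<pi> t\<close>, \<open>phi\<close> is a linear function minus a multiple of
  \<open>\<Sum> e(k\<^sup>2 x) / k\<^sup>2\<close>, so its increments are controlled, by partial summation, by the quadratic
  exponential sums \<open>\<Sum>\<^bsub>k\<le>n\<^esub> e(k\<^sup>2 x)\<close>.  Weyl's inequality bounds these by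
  \<open>q\<^bsup>\<epsilon>\<^esup> (n q\<^bsup>-1/2\<^esup> + q\<^bsup>1/2\<^esup>)\<close> whenever \<open>|x - p/q| \<le> 2 / q\<^sup>2\<close>.  This has two consequences.
  The ball of radius \<open>r \<le> q\<^bsup>-2\<^esup>\<close> around \<open>p/q\<close> has an image of diameter at most
  \<open>C q\<^bsup>\<epsilon>-1/2\<^esup> r\<^bsup>1/2\<^esup>\<close>.  And if \<open>|x - p/q| \<ge> c q\<^bsup>-\<mu>\<^esup>\<close> for all \<open>p/q\<close>, then the Hoelder exponent
  at \<open>x\<close> is at least \<open>1/2 + 1/(2\<mu>)\<close>.  Hence an irrational point of exponent at most \<open>\<alpha>\<close> lies in
  infinitely many balls of radius \<open>q\<^bsup>-\<mu>\<^esup>\<close> for each \<open>\<mu> < 1/(2\<alpha> - 1)\<close>, and covering by the images of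
  these balls gives dimension at most \<open>4/(\<mu> + 1)\<close>, which tends to \<open>(4\<alpha> - 2)/\<alpha>\<close>.
\<close>

section \<open>Weyl's inequality\<close>

text \<open>Up to 1/6 the difference sin (pi x) - x increases, because pi cos (pi x) is at least
  pi/2 there; from 1/6 to 1/2 the sine is already at least 1/2.\<close>

lemma abs_le_abs_sin_pi:
  fixes u :: real
  assumes "\<bar>u\<bar> \<le> 1/2"
  shows "\<bar>u\<bar> \<le> \<bar>sin (pi * u)\<bar>"
proof -
  have *: "u \<le> sin (pi * u)" if u: "0 \<le> u" "u \<le> 1/2" for u :: real
  proof (cases "u \<le> 1/6")
    case True
    have "((\<lambda>x. sin (pi * x) - x) has_real_derivative pi * cos (pi * x) - 1) (at x)" for x
      by (auto intro!: derivative_eq_intros)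
    moreover have "pi * cos (pi * x) - 1 \<ge> 0" if "0 \<le> x" "x \<le> u" for x
    proof -
      have "pi * x \<le> pi / 6" using that True by (simp add: field_simps)
      then have "cos (pi * x) \<ge> cos (pi/3)"
        using that by (intro cos_monotone_0_pi_le) (auto intro: order_trans[of _ "pi/6"])
      then have "cos (pi * x) \<ge> 1/2" by (simp add: cos_60)
      then have "pi * cos (pi * x) \<ge> 2 * (1/2)"
        using pi_gt3 by (intro mult_mono) auto
      then show ?thesis by simp
    qed
    ultimately have "sin (pi * 0) - 0 \<le> sin (pi * u) - u"
      using u by (intro DERIV_nonneg_imp_nondecreasing[where f = "\<lambda>x. sin (pi * x) - x"]) blast+
    then show ?thesis by simp
  next
    case False
    have "sin (pi/6) \<le> sin (pi * u)"
      using u False by (intro sin_monotone_2pi_le) (auto simp: field_simps)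
    then show ?thesis using u by (simp add: sin_30)
  qed
  show ?thesis
    using *[of u] *[of "-u"] assms by (cases "u \<ge> 0") (auto simp: abs_if)
qed

lemma norm_one_minus_cis: "norm (1 - cis \<theta>) = 2 * \<bar>sin (\<theta> / 2)\<bar>"
proof -
  have "1 - cis \<theta> = - 2 * \<i> * complex_of_real (sin (\<theta> / 2)) * cis (\<theta> / 2)"
    using sin_double[of "\<theta>/2"] cos_double_sin[of "\<theta>/2"]
    by (simp add: complex_eq_iff power2_eq_square)
  then show ?thesis by (simp add: norm_mult)
qed

text \<open>Reducing \<open>w\<close> modulo 1 leaves every term unchanged, and the geometric series
  is at most 2 / |1 - z| with |1 - z| = 2 |sin (pi u)|. The product form also covers integral
  \<open>w\<close>, where a quotient bound would degenerate.\<close>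

lemma norm_sum_cis_mult_le:
  "norm (\<Sum>n<L. cis (2 * pi * w * real n)) * \<bar>w - of_int (round w)\<bar> \<le> 1"
proof -
  define u where "u = w - of_int (round w)"
  have u: "\<bar>u\<bar> \<le> 1/2"
    using of_int_round_abs_le[of w] by (simp add: u_def abs_minus_commute)
  define z where "z = cis (2 * pi * u)"
  have z: "z = cis (2 * pi * w)"
  proof -
    have "cis (2 * pi * w) = z * cis (2 * pi * of_int (round w))"
      by (simp add: z_def u_def cis_mult algebra_simps)
    then show ?thesis by simp
  qed
  have "cis (2 * pi * w * real n) = z ^ n" for n
    unfolding z Complex.DeMoivre by (simp add: mult_ac)
  then have eq: "(\<Sum>n<L. cis (2 * pi * w * real n)) = (\<Sum>n<L. z ^ n)"
    by simp
  have "norm (1 - z) * norm (\<Sum>n<L. z ^ n) = norm (1 - z ^ L)"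
    by (simp add: one_diff_power_eq norm_mult)
  also have "\<dots> \<le> 2"
    using norm_triangle_ineq4[of 1 "z ^ L"] by (simp add: norm_power z_def)
  finally have "2 * \<bar>sin (pi * u)\<bar> * norm (\<Sum>n<L. z ^ n) \<le> 2"
    by (simp add: z_def norm_one_minus_cis)
  moreover have "\<bar>u\<bar> * norm (\<Sum>n<L. z ^ n) \<le> \<bar>sin (pi * u)\<bar> * norm (\<Sum>n<L. z ^ n)"
    using abs_le_abs_sin_pi[OF u] by (intro mult_right_mono) auto
  ultimately have "\<bar>u\<bar> * norm (\<Sum>n<L. z ^ n) \<le> 1" by linarith
  then show ?thesis unfolding eq u_def[symmetric] by (subst mult.commute)
qed

text \<open>The shift makes the frequencies run from 1 to n, so that the increments in n are exactly
  the numerators of the theta series below.\<close>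

definition weyl_sum :: "nat \<Rightarrow> real \<Rightarrow> complex" where
  "weyl_sum n x = (\<Sum>k<n. cis (2 * pi * (real (Suc k))\<^sup>2 * x))"

text \<open>Expanding the square and grouping the pairs by their difference d cancels the quadratic
  phase: (n + d)^2 - n^2 is linear in n, which leaves geometric sums. Pairs in the opposite order
  give complex conjugates, whence the factor 2.\<close>

lemma weyl_differencing:
  "(norm (weyl_sum N x))\<^sup>2
     \<le> 2 * (\<Sum>d<N. norm (\<Sum>n<N - d. cis (2 * pi * (2 * real d * x) * real n)))"
proof -
  define a where "a k = cis (2 * pi * (real (Suc k))\<^sup>2 * x)" for k
  define g where "g d = norm (\<Sum>n<N - d. cis (2 * pi * (2 * real d * x) * real n))" for d
  have b: "a (n + d) * cnj (a n)
      = cis (2 * pi * x * (2 * real d + (real d)\<^sup>2)) * cis (2 * pi * (2 * real d * x) * real n)" for n d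
    by (simp add: a_def cis_cnj cis_mult algebra_simps power2_eq_square)
  have lower: "norm (\<Sum>n<N - d. a (n + d) * cnj (a n)) = g d" for d
    by (simp add: b g_def sum_distrib_left[symmetric] norm_mult)
  have "(\<Sum>n<N - d. a n * cnj (a (n + d))) = cnj (\<Sum>n<N - d. a (n + d) * cnj (a n))" for d
    by (simp add: cnj_sum mult.commute)
  then have upper: "norm (\<Sum>n<N - d. a n * cnj (a (n + d))) = g d" for d
    by (simp only: complex_mod_cnj lower)
  define P where "P = {(m, n). n \<le> m \<and> m < N}"
  define Q where "Q = {(m, n). m < n \<and> n < (N::nat)}"
  have fin: "finite P" "finite Q"
    by (rule finite_subset[of _ "{..<N} \<times> {..<N}"]; force simp: P_def Q_def)+
  have split: "{..<N} \<times> {..<N} = P \<union> Q" "P \<inter> Q = {}"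
    by (auto simp: P_def Q_def)
  have "complex_of_real ((norm (weyl_sum N x))\<^sup>2) = (\<Sum>m<N. a m) * cnj (\<Sum>n<N. a n)"
    by (simp only: complex_norm_square weyl_sum_def a_def)
  also have "\<dots> = (\<Sum>(m, n)\<in>{..<N} \<times> {..<N}. a m * cnj (a n))"
    by (simp add: sum_product sum.cartesian_product cnj_sum)
  also have "\<dots> = (\<Sum>(m, n)\<in>P. a m * cnj (a n)) + (\<Sum>(m, n)\<in>Q. a m * cnj (a n))"
    unfolding split(1) using fin split(2) by (rule sum.union_disjoint)
  also have "(\<Sum>(m, n)\<in>P. a m * cnj (a n))
      = (\<Sum>(d, n)\<in>(SIGMA d:{..<N}. {..<N - d}). a (n + d) * cnj (a n))"
    by (rule sum.reindex_bij_witness[where i = "\<lambda>(d, n). (n + d, n)" and j = "\<lambda>(m, n). (m - n, n)"])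
       (auto simp: P_def)
  also have "\<dots> = (\<Sum>d<N. \<Sum>n<N - d. a (n + d) * cnj (a n))"
    by (simp add: sum.Sigma)
  also have "(\<Sum>(m, n)\<in>Q. a m * cnj (a n))
      = (\<Sum>(d, n)\<in>(SIGMA d:{1..<N}. {..<N - d}). a n * cnj (a (n + d)))"
    by (rule sum.reindex_bij_witness[where i = "\<lambda>(d, n). (n, n + d)" and j = "\<lambda>(m, n). (n - m, m)"])
       (auto simp: Q_def)
  also have "\<dots> = (\<Sum>d=1..<N. \<Sum>n<N - d. a n * cnj (a (n + d)))"
    by (simp add: sum.Sigma)
  finally have "norm (complex_of_real ((norm (weyl_sum N x))\<^sup>2))
      \<le> (\<Sum>d<N. norm (\<Sum>n<N - d. a (n + d) * cnj (a n)))
        + (\<Sum>d=1..<N. norm (\<Sum>n<N - d. a n * cnj (a (n + d))))"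
    by (simp only:) (intro order_trans[OF norm_triangle_ineq] add_mono norm_sum)
  also have "\<dots> = (\<Sum>d<N. g d) + (\<Sum>d=1..<N. g d)"
    by (simp only: lower upper)
  \<comment> \<open>The diagonal d = 0 occurs once in the square; counting it twice lets a single
    sum serve both halves.\<close>
  also have "(\<Sum>d=1..<N. g d) \<le> (\<Sum>d<N. g d)"
    by (rule sum_mono2) (auto simp: g_def)
  finally show ?thesis by (simp add: g_def norm_power)
qed

text \<open>A spacing argument: on a short block of d, different points 2 d y fall into different
  cells modulo 1, so the bounds 1 / distance add up to a harmonic sum. Only the two cells touching 0
  have to be charged the trivial bound \<open>N\<close>.\<close>

lemma sum_block_le:
  fixes p :: int and q :: nat and I :: "nat set" and a :: "nat \<Rightarrow> real" and N y :: real
  assumes cop: "coprime p (int q)" and q: "q > 0"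
    and y: "\<bar>y - of_int p / real q\<bar> \<le> 2 / (real q)\<^sup>2"
    and I: "finite I" "\<And>d d'. d \<in> I \<Longrightarrow> d' \<in> I \<Longrightarrow> 8 * \<bar>int d - int d'\<bar> < int q"
    and N: "0 \<le> N" and a_le: "\<And>d. d \<in> I \<Longrightarrow> a d \<le> N"
    and a: "\<And>d. d \<in> I \<Longrightarrow> a d * \<bar>2 * real d * y - of_int (round (2 * real d * y))\<bar> \<le> 1"
  shows "(\<Sum>d\<in>I. a d) \<le> 2 * N + 4 * real q * harm q"
proof -
  define v where "v d = 2 * real d * y - of_int (round (2 * real d * y))" for d :: nat
  define j where "j d = \<lfloor>2 * real q * v d\<rfloor>" for d
  \<comment> \<open>\<open>W i\<close> bounds \<open>a d\<close> when \<open>v d\<close> lies in the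
    cell [i/(2q), (i+1)/(2q)): the endpoint nearest to 0 has numerator i on the right and i + 1 on
    the left, which explains the shift by one for negative cells.\<close>
  define W where "W i = (if i = 0 \<or> i = -1 then N
      else if i > 0 then 2 * real q / of_int i else 2 * real q / of_int (- i - 1))" for i :: int
  have v: "\<bar>v d\<bar> \<le> 1/2" for d
    using of_int_round_abs_le[of "2 * real d * y"] by (simp add: v_def abs_minus_commute)
  have j: "of_int (j d) \<le> 2 * real q * v d" "2 * real q * v d < of_int (j d) + 1" for d
    unfolding j_def by linarith+
  have j_range: "j d \<in> {- int q..int q}" for d
  proof -
    have "\<bar>2 * real q * v d\<bar> \<le> 2 * real q * (1/2)"
      unfolding abs_mult using v[of d] by (intro mult_mono) auto
    then have "- real q \<le> 2 * real q * v d" "2 * real q * v d \<le> real q" by auto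
    then show ?thesis unfolding j_def by (auto simp: le_floor_iff floor_le_iff)
  qed
  \<comment> \<open>On \<open>I\<close> the points \<open>2 d y\<close> are \<open>1/(2q)\<close>-separated modulo 1, so each cell of length
    \<open>1/(2q)\<close> contains at most one of them.\<close>
  have inj: "inj_on j I"
  proof (rule inj_onI)
    fix d d' assume d: "d \<in> I" "d' \<in> I" and eq: "j d = j d'"
    \<comment> \<open>Sharing a cell gives |e y - m| < 1/(2q), and |e| \<le> q/4 gives |e (y - p/q)|
      \<le> 1/(2q). Together they force the integer e p - m q to be 0, so q divides e, which is
      smaller than q.\<close>
    define e where "e = 2 * (int d - int d')"
    define m where "m = round (2 * real d * y) - round (2 * real d' * y)"
    have e: "4 * \<bar>e\<bar> < int q" using I(2)[OF d] unfolding e_def by arith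
    have "\<bar>2 * real q * v d - 2 * real q * v d'\<bar> < 1"
      using j[of d] j[of d'] eq by linarith
    moreover have "2 * real q * v d - 2 * real q * v d' = 2 * real q * (of_int e * y - of_int m)"
      by (simp add: v_def e_def m_def algebra_simps)
    ultimately have 1: "2 * real q * \<bar>of_int e * y - of_int m\<bar> < 1"
      by (simp add: abs_mult)
    have "4 * \<bar>real_of_int e\<bar> \<le> real q" using e by linarith
    then have "(4 * \<bar>real_of_int e\<bar>) * \<bar>y - of_int p / real q\<bar> \<le> real q * (2 / (real q)\<^sup>2)"
      using y by (intro mult_mono) auto
    also have "\<dots> = 2 / real q" using q by (simp add: power2_eq_square)
    finally have "2 * (\<bar>real_of_int e\<bar> * \<bar>y - of_int p / real q\<bar>) \<le> 1 / real q" by simp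
    then have "real q * (2 * (\<bar>real_of_int e\<bar> * \<bar>y - of_int p / real q\<bar>)) \<le> real q * (1 / real q)"
      by (intro mult_left_mono) auto
    then have 2: "2 * real q * \<bar>of_int e * (y - of_int p / real q)\<bar> \<le> 1"
      using q by (simp add: abs_mult mult_ac)
    have "2 * \<bar>of_int e * of_int p - of_int m * real q\<bar>
        = 2 * real q * \<bar>(of_int e * y - of_int m) - of_int e * (y - of_int p / real q)\<bar>"
    proof -
      have "of_int e * of_int p - of_int m * real q
          = real q * ((of_int e * y - of_int m) - of_int e * (y - of_int p / real q))"
        using q by (simp add: field_simps)
      then show ?thesis by (simp add: abs_mult)
    qed
    also have "\<dots> \<le> 2 * real q * (\<bar>of_int e * y - of_int m\<bar> + \<bar>of_int e * (y - of_int p / real q)\<bar>)"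
      by (intro mult_left_mono abs_triangle_ineq4) auto
    also have "\<dots> < 2" using 1 2 by (simp add: algebra_simps)
    finally have "\<bar>real_of_int (e * p - m * int q)\<bar> < 1" by simp
    then have "e * p = m * int q" by linarith
    then have "int q dvd e * p" by simp
    then have "int q dvd e" using cop by (simp add: coprime_commute coprime_dvd_mult_left_iff)
    moreover have "\<bar>e\<bar> < int q" using e by linarith
    ultimately have "e = 0" using zdvd_imp_le[of "int q" "\<bar>e\<bar>"] by (cases "e = 0") auto
    then show "d = d'" by (simp add: e_def)
  qed
  have aW: "a d \<le> W (j d)" if d: "d \<in> I" for d
  proof -
    have mult_le: "a d \<le> 2 * real q / c" if c: "c > 0" "c \<le> 2 * real q * \<bar>v d\<bar>" for c
    proof (cases "a d \<ge> 0")
      case True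
      have "a d * c \<le> a d * (2 * real q * \<bar>v d\<bar>)"
        using True c by (intro mult_left_mono) auto
      also have "\<dots> = 2 * real q * (a d * \<bar>v d\<bar>)" by simp
      also have "\<dots> \<le> 2 * real q * 1" using a[OF d] by (intro mult_left_mono) (auto simp: v_def)
      finally show ?thesis using c by (simp add: field_simps)
    next
      case False
      then have "a d \<le> 0" by simp
      also have "0 \<le> 2 * real q / c" using c by simp
      finally show ?thesis .
    qed
    have abs_v: "2 * real q * \<bar>v d\<bar> = \<bar>2 * real q * v d\<bar>" by (simp add: abs_mult)
    consider "j d = 0 \<or> j d = -1" | "j d > 0" | "j d < -1" by linarith
    then show ?thesis
    proof cases
      case 1
      then show ?thesis using a_le[OF d] by (auto simp: W_def)
    next
      case 2
      then have "a d \<le> 2 * real q / of_int (j d)"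
        using j[of d] by (intro mult_le) (auto simp: abs_v)
      then show ?thesis using 2 by (simp add: W_def)
    next
      case 3
      then have "real_of_int (- j d - 1) > 0" by linarith
      moreover have "of_int (- j d - 1) \<le> 2 * real q * \<bar>v d\<bar>"
        unfolding abs_v using j[of d] by simp
      ultimately have "a d \<le> 2 * real q / of_int (- j d - 1)" by (rule mult_le)
      then show ?thesis using 3 by (simp add: W_def)
    qed
  qed
  have W_nonneg: "0 \<le> W i" for i using N by (auto simp: W_def)
  \<comment> \<open>With this parametrisation \<open>W\<close> equals 2 q / i on both families, so
    each contributes the same harmonic sum.\<close>
  let ?P = "int ` {1..q}" and ?M = "(\<lambda>i. - int i - 1) ` {1..q}"
  have "(\<Sum>d\<in>I. a d) \<le> (\<Sum>d\<in>I. W (j d))" by (intro sum_mono aW)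
  also have "\<dots> = sum W (j ` I)" using inj by (simp add: sum.reindex)
  also have "\<dots> \<le> sum W ({0, -1} \<union> ?P \<union> ?M)"
  proof (rule sum_mono2)
    show "j ` I \<subseteq> {0, -1} \<union> ?P \<union> ?M"
    proof
      fix i assume "i \<in> j ` I"
      then have i: "- int q \<le> i" "i \<le> int q" using j_range by auto
      consider "i = 0" | "i = -1" | "i \<ge> 1" | "i \<le> -2" by linarith
      then show "i \<in> {0, -1} \<union> ?P \<union> ?M"
      proof cases
        case 3 then have "i = int (nat i)" "nat i \<in> {1..q}" using i by auto
        then show ?thesis by blast
      next
        case 4 then have "i = - int (nat (- i - 1)) - 1" "nat (- i - 1) \<in> {1..q}" using i by auto
        then show ?thesis by blast
      qed auto
    qed
  qed (auto intro: W_nonneg)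
  also have "\<dots> = sum W {0, -1} + sum W ?P + sum W ?M"
    by (subst sum.union_disjoint; (subst sum.union_disjoint)?; auto)
  also have "sum W {0, -1} = 2 * N" by (simp add: W_def)
  also have "sum W ?P = 2 * real q * harm q"
    by (subst sum.reindex) (auto simp: harm_def sum_distrib_left W_def field_simps intro!: sum.cong)
  also have "sum W ?M = 2 * real q * harm q"
    by (subst sum.reindex)
       (auto simp: harm_def sum_distrib_left W_def field_simps inj_on_def intro!: sum.cong)
  finally show ?thesis by (simp add: algebra_simps)
qed

text \<open>Weyl differencing leaves a sum over d < N. It is cut into at most 8 (N/q + 1) blocks
  short enough for the spacing argument, each contributing at most 2 N + 4 q
  \<open>harm q\<close>.\<close>

lemma norm_weyl_sum_square_le:
  fixes p :: int and q N :: nat and y :: real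
  assumes cop: "coprime p (int q)" and q: "q > 0"
    and y: "\<bar>y - of_int p / real q\<bar> \<le> 2 / (real q)\<^sup>2"
  shows "(norm (weyl_sum N y))\<^sup>2 \<le> 64 * harm q * (real N + real q)\<^sup>2 / real q"
proof -
  define a where "a d = norm (\<Sum>n<N - d. cis (2 * pi * (2 * real d * y) * real n))" for d
  have a_le: "a d \<le> real N" for d
  proof -
    have "a d \<le> (\<Sum>n<N - d. norm (cis (2 * pi * (2 * real d * y) * real n)))"
      unfolding a_def by (rule norm_sum)
    then show ?thesis by simp
  qed
  \<comment> \<open>\<open>L\<close> is q/8 rounded up: 8 (L - 1) < q gives the separation inside a
    block, while q \<le> 8 L limits the number of blocks.\<close>
  define L where "L = (q + 7) div 8"
  define B where "B = N div L + 1"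
  define E where "E = 2 * real N + 4 * real q * harm q"
  have L: "L > 0" "8 * (L - 1) < q" "q \<le> 8 * L" using q by (auto simp: L_def)
  have harm: "(harm q :: real) \<ge> 1"
  proof -
    have "inverse (real 1) \<le> harm q"
      unfolding harm_def using q by (intro member_le_sum[of 1 _ "\<lambda>k. inverse (real k)"]) auto
    then show ?thesis by simp
  qed
  have E: "E \<ge> 0" using harm by (simp add: E_def)
  have NBL: "N \<le> B * L"
    using L(1) by (simp add: B_def dividend_less_div_times order_less_imp_le)
  have block: "sum a {b * L..<b * L + L} \<le> E" for b
    unfolding E_def
  proof (rule sum_block_le[OF cop q y])
    show "8 * \<bar>int d - int d'\<bar> < int q"
      if "d \<in> {b * L..<b * L + L}" "d' \<in> {b * L..<b * L + L}" for d d'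
    proof -
      have "8 * (int L - 1) < int q" using L by presburger
      moreover have "\<bar>int d - int d'\<bar> \<le> int L - 1"
        using that unfolding atLeastLessThan_iff by linarith
      ultimately show ?thesis by (smt (verit))
    qed
    show "a d * \<bar>2 * real d * y - real_of_int (round (2 * real d * y))\<bar> \<le> 1" for d
      unfolding a_def by (rule norm_sum_cis_mult_le)
  qed (use a_le in auto)
  have "(norm (weyl_sum N y))\<^sup>2 \<le> 2 * (\<Sum>d<N. a d)"
    unfolding a_def by (rule weyl_differencing)
  also have "(\<Sum>d<N. a d) \<le> (\<Sum>d<B * L. a d)"
    using NBL by (intro sum_mono2) (auto simp: a_def)
  also have "\<dots> = (\<Sum>b<B. sum a {b * L..<b * L + L})"
    by (rule sum.nat_group[symmetric])
  also have "\<dots> \<le> (\<Sum>b<B. E)" by (intro sum_mono block)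
  also have "\<dots> = real B * E" by simp
  also have "real B \<le> 8 * (real N / real q + 1)"
  proof -
    have "real (N div L) * real L \<le> real N"
      by (simp only: of_nat_mult[symmetric] of_nat_le_iff div_times_less_eq_dividend)
    then have "real (N div L) \<le> real N / real L" using L(1) by (simp add: field_simps)
    also have "\<dots> \<le> real N / (real q / 8)"
      using L q by (intro divide_left_mono) auto
    finally show ?thesis by (simp add: B_def algebra_simps)
  qed
  also have "E \<le> 4 * harm q * (real N + real q)"
  proof -
    have "2 * real N * 1 \<le> 4 * real N * harm q" using harm by (intro mult_mono) auto
    then show ?thesis by (simp add: E_def algebra_simps)
  qed
  finally have "(norm (weyl_sum N y))\<^sup>2
      \<le> 2 * (8 * (real N / real q + 1) * (4 * harm q * (real N + real q)))"
    using E by (simp add: mult_right_mono mult_left_mono)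
  also have "\<dots> = 64 * harm q * (real N + real q)\<^sup>2 / real q"
    using q by (simp add: field_simps power2_eq_square)
  finally show ?thesis .
qed

text \<open>For k \<le> q one has 1/k \<le> q^\<epsilon> k^(-1-\<epsilon>), and the series of the
  k^(-1-\<epsilon>) converges. This absorbs the logarithmic size of the harmonic sum into a small
  power.\<close>

lemma harm_le_powr:
  fixes \<epsilon> :: real
  assumes "\<epsilon> > 0"
  obtains C where "C > 0" "\<And>q. harm q \<le> C * real q powr \<epsilon>"
proof
  have summ: "summable (\<lambda>n. real n powr (- 1 - \<epsilon>))"
    using assms by (simp add: summable_real_powr_iff)
  define C where "C = (\<Sum>n. real n powr (- 1 - \<epsilon>)) + 1"
  show "C > 0" unfolding C_def using suminf_nonneg[OF summ] by (simp add: add_nonneg_pos)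
  fix q :: nat
  have "harm q = (\<Sum>k=1..q. inverse (real k))" by (simp add: harm_def)
  also have "\<dots> \<le> (\<Sum>k=1..q. real q powr \<epsilon> * real k powr (- 1 - \<epsilon>))"
  proof (rule sum_mono)
    fix k assume k: "k \<in> {1..q}"
    have "inverse (real k) = real k powr \<epsilon> * real k powr (- 1 - \<epsilon>)"
      using k by (simp add: powr_add[symmetric] powr_minus)
    also have "\<dots> \<le> real q powr \<epsilon> * real k powr (- 1 - \<epsilon>)"
      using k assms by (intro mult_right_mono powr_mono2) auto
    finally show "inverse (real k) \<le> real q powr \<epsilon> * real k powr (- 1 - \<epsilon>)" .
  qed
  also have "\<dots> = real q powr \<epsilon> * (\<Sum>k=1..q. real k powr (- 1 - \<epsilon>))"
    by (simp add: sum_distrib_left)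
  also have "\<dots> \<le> real q powr \<epsilon> * C"
  proof (rule mult_left_mono)
    have "(\<Sum>k=1..q. real k powr (- 1 - \<epsilon>)) \<le> (\<Sum>n. real n powr (- 1 - \<epsilon>))"
      by (rule sum_le_suminf[OF summ]) auto
    then show "(\<Sum>k=1..q. real k powr (- 1 - \<epsilon>)) \<le> C" by (simp add: C_def)
  qed auto
  finally show "harm q \<le> C * real q powr \<epsilon>" by (simp add: mult.commute)
qed

theorem weyl_inequality:
  fixes \<epsilon> :: real
  assumes "\<epsilon> > 0"
  obtains C where "C > 0"
    "\<And>p q y n. coprime p (int q) \<Longrightarrow> q > 0 \<Longrightarrow> \<bar>y - of_int p / real q\<bar> \<le> 2 / (real q)\<^sup>2 \<Longrightarrow>
       norm (weyl_sum n y) \<le> C * real q powr \<epsilon> * (real n / sqrt (real q) + sqrt (real q))"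
proof -
  \<comment> \<open>The harmonic sum bounds the square of the Weyl sum, so the exponent 2 \<epsilon>
    becomes \<epsilon> after taking roots.\<close>
  obtain C where C: "C > 0" "\<And>q. harm q \<le> C * real q powr (2 * \<epsilon>)"
    using harm_le_powr[of "2 * \<epsilon>"] assms by auto
  show thesis
  proof (rule that)
    show "8 * sqrt C > 0" using C by simp
    fix p :: int and q n :: nat and y :: real
    assume *: "coprime p (int q)" "q > 0" "\<bar>y - of_int p / real q\<bar> \<le> 2 / (real q)\<^sup>2"
    let ?B = "8 * sqrt C * real q powr \<epsilon> * (real n / sqrt (real q) + sqrt (real q))"
    have sq: "(real n / sqrt (real q) + sqrt (real q))\<^sup>2 = (real n + real q)\<^sup>2 / real q"
    proof -
      have "real n / sqrt (real q) + sqrt (real q) = (real n + real q) / sqrt (real q)"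
        using *(2) by (simp add: field_simps)
      then show ?thesis by (simp add: power_divide)
    qed
    have pw: "(real q powr \<epsilon>)\<^sup>2 = real q powr (2 * \<epsilon>)"
      using *(2) by (simp add: powr_power mult.commute)
    have "(norm (weyl_sum n y))\<^sup>2 \<le> 64 * harm q * (real n + real q)\<^sup>2 / real q"
      using * by (rule norm_weyl_sum_square_le)
    also have "\<dots> = 64 * harm q * ((real n + real q)\<^sup>2 / real q)" by simp
    also have "\<dots> \<le> 64 * (C * real q powr (2 * \<epsilon>)) * ((real n + real q)\<^sup>2 / real q)"
      using C by (intro mult_right_mono mult_left_mono) auto
    also have "\<dots> = ?B\<^sup>2"
      using C(1) by (simp add: power_mult_distrib sq pw)
    finally show "norm (weyl_sum n y) \<le> ?B"
      by (rule power2_le_imp_le) (use C in auto)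
  qed
qed

section \<open>Increments of the quadratic theta series\<close>

text \<open>Summation by parts: the differences of the weights 1/k^2 have order 1/k^3, so linear
  growth of \<open>S\<close> leaves a tail of order 1/K and its constant part one of order 1/K^2.
  Uniformity in \<open>n\<close> allows passing to the infinite tail.\<close>

lemma norm_abel_sum_le:
  fixes S :: "nat \<Rightarrow> complex" and A B :: real
  assumes S: "\<And>n. norm (S n) \<le> A * real n + B" and A: "0 \<le> A" and B: "0 \<le> B" and K: "K > 0"
  shows "norm (\<Sum>k<n. (S (Suc (k + K)) - S (k + K)) / of_nat (Suc (k + K)) ^ 2)
    \<le> 3 * A / real K + 2 * B / (real K)\<^sup>2"
proof -
  define b where "b k = 1 / (real (Suc k))\<^sup>2" for k
  define T where "T n = (\<Sum>k<n. of_real (b (k + K)) * (S (Suc (k + K)) - S (k + K)))" for n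
  have b_mono: "b (Suc k) \<le> b k" for k
    unfolding b_def by (intro divide_left_mono power_mono) auto
  have b_nonneg: "b k \<ge> 0" for k by (simp add: b_def)
  have b_le: "b k \<le> 1 / real k - 1 / real (Suc k)" if "k > 0" for k
  proof -
    have "1 / real k - 1 / real (Suc k) = 1 / (real k * real (Suc k))"
      using that by (simp add: field_simps)
    moreover have "b k \<le> 1 / (real k * real (Suc k))"
      unfolding b_def power2_eq_square using that by (intro divide_left_mono mult_right_mono) auto
    ultimately show ?thesis by simp
  qed
  \<comment> \<open>Without its boundary terms \<open>T n\<close> is the summed-by-parts series. Its
    terms telescope once the leftover \<open>b M\<close> is bounded by 1/M - 1/(M+1).\<close>
  have ind: "norm (T n - of_real (b (n + K)) * S (n + K) + of_real (b K) * S K)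
      \<le> A * (1 / real K - 1 / real (n + K) + real K * b K - real (n + K) * b (n + K))
        + B * (b K - b (n + K))" for n
  proof (induction n)
    case 0
    then show ?case by (simp add: T_def)
  next
    case (Suc n)
    let ?M = "n + K"
    have "T (Suc n) - of_real (b (Suc n + K)) * S (Suc n + K) + of_real (b K) * S K
        = (T n - of_real (b ?M) * S ?M + of_real (b K) * S K)
          + of_real (b ?M - b (Suc ?M)) * S (Suc ?M)"
      by (simp add: T_def algebra_simps)
    also have "norm \<dots> \<le> norm (T n - of_real (b ?M) * S ?M + of_real (b K) * S K)
          + norm (of_real (b ?M - b (Suc ?M)) * S (Suc ?M))"
      by (rule norm_triangle_ineq)
    also have "norm (of_real (b ?M - b (Suc ?M)) * S (Suc ?M))
        \<le> (b ?M - b (Suc ?M)) * (A * real (Suc ?M) + B)"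
      unfolding norm_mult norm_of_real using b_mono[of ?M] S[of "Suc ?M"]
      by (intro mult_mono) auto
    also have "\<dots> = A * (real ?M * b ?M - real (Suc ?M) * b (Suc ?M) + b ?M) + B * (b ?M - b (Suc ?M))"
      by (simp add: algebra_simps)
    also have "\<dots> \<le> A * (real ?M * b ?M - real (Suc ?M) * b (Suc ?M) + (1 / real ?M - 1 / real (Suc ?M)))
         + B * (b ?M - b (Suc ?M))"
      using b_le[of ?M] A B K by (intro add_mono mult_left_mono) auto
    finally show ?case using Suc.IH by (simp add: algebra_simps)
  qed
  let ?M = "n + K"
  have 1: "norm (of_real (b ?M) * S ?M) \<le> b ?M * (A * real ?M + B)"
    unfolding norm_mult norm_of_real using S[of ?M] b_nonneg[of ?M] by (intro mult_mono) auto
  have 2: "norm (of_real (b K) * S K) \<le> b K * (A * real K + B)"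
    unfolding norm_mult norm_of_real using S[of K] b_nonneg[of K] by (intro mult_mono) auto
  have tri: "norm x \<le> norm (x - y + z) + norm y + norm z" for x y z :: complex
  proof -
    have "norm (x - y + z + y - z) \<le> norm (x - y + z + y) + norm z" by (rule norm_triangle_ineq4)
    also have "norm (x - y + z + y) \<le> norm (x - y + z) + norm y" by (rule norm_triangle_ineq)
    finally show ?thesis by simp
  qed
  have "norm (T n) \<le> norm (T n - of_real (b ?M) * S ?M + of_real (b K) * S K)
      + norm (of_real (b ?M) * S ?M) + norm (of_real (b K) * S K)"
    by (rule tri)
  also have "\<dots> \<le> A * (1 / real K - 1 / real ?M) + 2 * A * (real K * b K) + 2 * B * b K"
    using ind[of n] 1 2 by (simp add: algebra_simps)
  also have "\<dots> \<le> A * (1 / real K) + 2 * A * (1 / real K) + 2 * B * (1 / (real K)\<^sup>2)"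
  proof (intro add_mono mult_left_mono)
    show "b K \<le> 1 / (real K)\<^sup>2"
      unfolding b_def using K by (intro divide_left_mono power_mono) auto
    then have "real K * b K \<le> real K * (1 / (real K)\<^sup>2)" by (intro mult_left_mono) auto
    also have "\<dots> = 1 / real K" using K by (simp add: power2_eq_square)
    finally show "real K * b K \<le> 1 / real K" .
  qed (use A B in auto)
  also have "\<dots> = 3 * A / real K + 2 * B / (real K)\<^sup>2" by (simp add: field_simps)
  finally show ?thesis by (simp add: T_def b_def)
qed

text \<open>The imaginary part is Riemann's function, the sum of sin (k^2 u) / k^2 over k \<ge> 1,
  at u = 2 pi x.\<close>

definition theta_series :: "real \<Rightarrow> complex" where
  "theta_series x = (\<Sum>k. cis (2 * pi * (real (Suc k))\<^sup>2 * x) / of_nat (Suc k) ^ 2)"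

lemma summable_theta_series_norm:
  "summable (\<lambda>k. norm (cis (2 * pi * (real (Suc k))\<^sup>2 * x) / of_nat (Suc k) ^ 2))"
proof -
  have "summable (\<lambda>k. inverse (real (Suc k) ^ 2))"
    by (subst summable_Suc_iff) (rule inverse_power_summable, simp)
  moreover have "norm (cis (2 * pi * (real (Suc k))\<^sup>2 * x) / of_nat (Suc k) ^ 2)
      = inverse (real (Suc k) ^ 2)" for k
    by (simp only: norm_divide norm_power norm_of_nat norm_cis inverse_eq_divide)
  ultimately show ?thesis by presburger
qed

lemmas summable_theta_series = summable_norm_cancel[OF summable_theta_series_norm]

text \<open>The terms are increments of Weyl sums divided by k^2, so the Abel bound applies to the
  finite pieces of the tail and survives the limit.\<close>

lemma norm_theta_series_tail_le:
  fixes A B y :: real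
  assumes S: "\<And>n. norm (weyl_sum n y) \<le> A * real n + B" and A: "0 \<le> A" and B: "0 \<le> B" and K: "K > 0"
  shows "norm (theta_series y - (\<Sum>k<K. cis (2 * pi * (real (Suc k))\<^sup>2 * y) / of_nat (Suc k) ^ 2))
    \<le> 3 * A / real K + 2 * B / (real K)\<^sup>2"
proof -
  define c where "c k = cis (2 * pi * (real (Suc k))\<^sup>2 * y) / of_nat (Suc k) ^ 2" for k
  have sum: "summable c" unfolding c_def by (rule summable_theta_series)
  then have "(\<lambda>n. norm (\<Sum>k<n. c (k + K))) \<longlonglongrightarrow> norm (\<Sum>k. c (k + K))"
    by (intro tendsto_norm summable_LIMSEQ) (simp add: summable_iff_shift)
  moreover have "norm (\<Sum>k<n. c (k + K)) \<le> 3 * A / real K + 2 * B / (real K)\<^sup>2" for n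
  proof -
    have "c (k + K) = (weyl_sum (Suc (k + K)) y - weyl_sum (k + K) y) / of_nat (Suc (k + K)) ^ 2" for k
      by (simp add: weyl_sum_def c_def)
    then show ?thesis using norm_abel_sum_le[OF S A B K, of n] by simp
  qed
  ultimately have "norm (\<Sum>k. c (k + K)) \<le> 3 * A / real K + 2 * B / (real K)\<^sup>2"
    by (intro LIMSEQ_le_const2) blast+
  moreover have "theta_series y - (\<Sum>k<K. c k) = (\<Sum>k. c (k + K))"
    using suminf_split_initial_segment[OF sum, of K] unfolding theta_series_def c_def[symmetric] by simp
  ultimately show ?thesis by (simp add: c_def)
qed

text \<open>Differentiation multiplies the k-th term by 2 pi i k^2, which cancels the weight 1/k^2:
  the derivative of the head is 2 pi i times a Weyl sum, and the mean value inequality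
  finishes.\<close>

lemma norm_theta_series_head_diff_le:
  fixes x h M :: real
  assumes S: "\<And>y. y \<in> closed_segment x (x + h) \<Longrightarrow> norm (weyl_sum K y) \<le> M"
  shows "norm ((\<Sum>k<K. cis (2 * pi * (real (Suc k))\<^sup>2 * (x + h)) / of_nat (Suc k) ^ 2)
      - (\<Sum>k<K. cis (2 * pi * (real (Suc k))\<^sup>2 * x) / of_nat (Suc k) ^ 2)) \<le> 2 * pi * M * \<bar>h\<bar>"
proof -
  define w where "w k = complex_of_real (2 * pi * (real (Suc k))\<^sup>2) * \<i>" for k
  define f where "f z = (\<Sum>k<K. exp (w k * z) / of_nat (Suc k) ^ 2)" for z
  define f' where "f' z = (\<Sum>k<K. exp (w k * z) * w k / of_nat (Suc k) ^ 2)" for z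
  have exp_w: "exp (w k * of_real t) = cis (2 * pi * (real (Suc k))\<^sup>2 * t)" for k t
    by (simp add: w_def cis_conv_exp mult_ac)
  have w_div: "w k / of_nat (Suc k) ^ 2 = 2 * pi * \<i>" for k
    by (simp add: w_def del: of_nat_Suc)
  have f': "f' (of_real t) = 2 * pi * \<i> * weyl_sum K t" for t
  proof -
    have "f' (of_real t) = (\<Sum>k<K. cis (2 * pi * (real (Suc k))\<^sup>2 * t) * (w k / of_nat (Suc k) ^ 2))"
      unfolding f'_def exp_w by simp
    then show ?thesis unfolding w_div weyl_sum_def sum_distrib_left by (simp add: mult.commute)
  qed
  have "norm (f (of_real (x + h)) - f (of_real x)) \<le> (2 * pi * M) * norm (complex_of_real (x + h) - of_real x)"
  proof (rule field_differentiable_bound)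
    show "(f has_field_derivative f' z) (at z within closed_segment (of_real x) (of_real (x + h)))" for z
      unfolding f_def f'_def by (intro DERIV_sum DERIV_cdivide) (auto intro!: derivative_eq_intros)
    fix z assume "z \<in> closed_segment (complex_of_real x) (of_real (x + h))"
    then obtain t where t: "z = of_real t" "t \<in> closed_segment x (x + h)"
      unfolding closed_segment_of_real by blast
    then show "norm (f' z) \<le> 2 * pi * M"
      using S[OF t(2)] by (simp add: f' norm_mult)
  qed auto
  then show ?thesis unfolding f_def exp_w by simp
qed

text \<open>The series is cut at K near |h|^(-1/2), which balances the tail A/K at both endpoints
  against the head A K |h|.\<close>

lemma norm_theta_series_diff_le:
  fixes x h A B :: real
  assumes S: "\<And>n y. y \<in> closed_segment x (x + h) \<Longrightarrow> norm (weyl_sum n y) \<le> A * real n + B"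
    and A: "0 \<le> A" and B: "0 \<le> B" and h: "\<bar>h\<bar> \<le> 1"
  shows "norm (theta_series (x + h) - theta_series x) \<le> 22 * (A * sqrt \<bar>h\<bar> + B * \<bar>h\<bar>)"
proof (cases "h = 0")
  case False
  define s where "s = sqrt \<bar>h\<bar>"
  have s: "0 < s" "s \<le> 1" "s\<^sup>2 = \<bar>h\<bar>" using False h by (auto simp: s_def)
  define K where "K = nat \<lceil>1 / s\<rceil>"
  have K: "1 / s \<le> real K" "real K \<le> 1 / s + 1"
    unfolding K_def using s by (auto simp: of_nat_nat intro: less_imp_le)
  have K1: "K > 0" using K s by (cases K) auto
  \<comment> \<open>Here |h| \<le> 1 keeps the rounding in \<open>K\<close> within a factor
    2.\<close>
  have "1 \<le> 1 / s" using s by simp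
  then have K2: "real K \<le> 2 / s" using K by simp
  define H where "H y = (\<Sum>k<K. cis (2 * pi * (real (Suc k))\<^sup>2 * y) / of_nat (Suc k) ^ 2)" for y
  have Ks: "1 / real K \<le> s" using K s K1 by (simp add: field_simps)
  then have "(1 / real K)\<^sup>2 \<le> s\<^sup>2" by (intro power_mono) auto
  then have "2 * B * (1 / real K)\<^sup>2 \<le> 2 * B * s\<^sup>2"
    using B by (intro mult_left_mono) auto
  moreover have "3 * A * (1 / real K) \<le> 3 * A * s"
    using A by (intro mult_left_mono Ks) auto
  ultimately have tail_le: "3 * A / real K + 2 * B / (real K)\<^sup>2 \<le> 3 * A * s + 2 * B * \<bar>h\<bar>"
    using s by (simp add: power_divide)
  have tail: "norm (theta_series y - H y) \<le> 3 * A * s + 2 * B * \<bar>h\<bar>"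
    if "y \<in> closed_segment x (x + h)" for y
    unfolding H_def using norm_theta_series_tail_le[OF S[OF that] A B K1] tail_le by simp
  have "norm (H (x + h) - H x) \<le> 2 * pi * (A * real K + B) * \<bar>h\<bar>"
    unfolding H_def by (rule norm_theta_series_head_diff_le) (rule S)
  also have "\<dots> \<le> 2 * 4 * (A * (2 / s) + B) * \<bar>h\<bar>"
    using A B K2 pi_less_4 by (intro mult_right_mono mult_mono add_mono mult_left_mono) auto
  also have "\<dots> = 8 * B * \<bar>h\<bar> + 16 * A * (\<bar>h\<bar> / s)" by (simp add: algebra_simps)
  also have "\<bar>h\<bar> / s = s" using s by (simp add: s(3)[symmetric] power2_eq_square)
  finally have head: "norm (H (x + h) - H x) \<le> 8 * B * \<bar>h\<bar> + 16 * A * s" .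
  have "theta_series (x + h) - theta_series x
      = (theta_series (x + h) - H (x + h)) + (H (x + h) - H x) - (theta_series x - H x)" by simp
  also have "norm \<dots> \<le> norm (theta_series (x + h) - H (x + h)) + norm (H (x + h) - H x)
      + norm (theta_series x - H x)"
    by (intro order_trans[OF norm_triangle_ineq4] add_mono norm_triangle_ineq order_refl)
  also have "\<dots> \<le> (3 * A * s + 2 * B * \<bar>h\<bar>) + (8 * B * \<bar>h\<bar> + 16 * A * s) + (3 * A * s + 2 * B * \<bar>h\<bar>)"
    by (intro add_mono tail head) auto
  also have "\<dots> = 22 * (A * s) + 12 * (B * \<bar>h\<bar>)" by (simp add: algebra_simps)
  also have "\<dots> \<le> 22 * (A * s) + 22 * (B * \<bar>h\<bar>)" using B by simp
  finally show ?thesis by (simp add: s_def)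
qed auto

section \<open>Increments of phi and rational approximation\<close>

text \<open>The terms at k and -k agree, so the nonzero frequencies give twice a sum over k \<ge> 1,
  and -4 pi^2 k^2 t = 2 pi k^2 x with x = -2 pi t. The summand i t is the term k = 0.\<close>

lemma phi_eq_theta_series:
  "phi t = \<i> * complex_of_real t + (theta_series 0 - theta_series (- 2 * pi * t)) / (2 * pi\<^sup>2)"
proof -
  define c where "c x k = cis (2 * pi * (real (Suc k))\<^sup>2 * x) / of_nat (Suc k) ^ 2" for x k
  define u where "u k = (c 0 k - c (- 2 * pi * t) k) / (4 * pi\<^sup>2)" for k
  define s where "s = (theta_series 0 - theta_series (- 2 * pi * t)) / (4 * pi\<^sup>2)"
  have c_sums: "c x sums theta_series x" for x
    unfolding theta_series_def c_def by (intro summable_sums summable_theta_series)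
  have "u sums s"
    unfolding u_def s_def by (intro sums_divide sums_diff c_sums)
  \<comment> \<open>Absolute convergence turns the ordered series into an unordered sum, the kind
    that defines \<open>phi\<close>.\<close>
  moreover have "summable (\<lambda>k. norm (u k))"
  proof (rule summable_comparison_test')
    have "summable (\<lambda>k. norm (c x k))" for x
      unfolding c_def by (rule summable_theta_series_norm)
    then show "summable (\<lambda>k. (norm (c 0 k) + norm (c (- 2 * pi * t) k)) / (4 * pi\<^sup>2))"
      by (intro summable_divide summable_add)
    show "norm (norm (u k)) \<le> (norm (c 0 k) + norm (c (- 2 * pi * t) k)) / (4 * pi\<^sup>2)" if "k \<ge> 0" for k
      unfolding u_def by (simp add: norm_divide norm_mult norm_power divide_right_mono norm_triangle_ineq4)
  qed
  ultimately have u: "(u has_sum s) UNIV" by (intro norm_summable_imp_has_sum)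
  have term_eq: "phi_term t k = u n" if "k\<^sup>2 = (int (Suc n))\<^sup>2" for k n
  proof -
    have k: "k \<noteq> 0" using that by auto
    have k2: "complex_of_int (k\<^sup>2) = of_nat (Suc n) ^ 2" unfolding that by simp
    have "exp (- (4 * complex_of_real (pi^2) * \<i> * of_int (k^2) * complex_of_real t))
        = cis (2 * pi * (real (Suc n))\<^sup>2 * (- 2 * pi * t))"
      unfolding k2 by (simp add: cis_conv_exp power2_eq_square mult_ac)
    then show ?thesis
      using k unfolding phi_term_def k2 u_def c_def
      by (simp add: diff_divide_distrib minus_divide_left[symmetric] mult_ac del: of_nat_Suc)
  qed
  let ?P = "range (\<lambda>n. int (Suc n))" and ?M = "range (\<lambda>n. - int (Suc n))"
  have "(phi_term t has_sum s) ?P"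
    using u by (subst has_sum_reindex) (auto simp: inj_on_def o_def term_eq)
  moreover have "(phi_term t has_sum s) ?M"
  proof (subst has_sum_reindex)
    have "phi_term t \<circ> (\<lambda>n. - int (Suc n)) = u"
      by (rule ext, unfold o_def, rule term_eq) (rule power2_minus)
    then show "(phi_term t \<circ> (\<lambda>n. - int (Suc n)) has_sum s) UNIV" using u by simp
  qed (auto simp: inj_on_def)
  moreover have "(phi_term t has_sum (\<i> * t)) {0}"
    by (rule has_sum_finiteI) (auto simp: phi_term_def)
  ultimately have "(phi_term t has_sum (\<i> * t + (s + s))) ({0} \<union> (?P \<union> ?M))"
    by (intro has_sum_Un_disjoint) auto
  moreover have "{0} \<union> (?P \<union> ?M) = UNIV"
  proof -
    have "k \<in> {0} \<union> (?P \<union> ?M)" for k :: int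
    proof (cases k "0 :: int" rule: linorder_cases)
      case less
      then have "k = - int (Suc (nat (- k - 1)))" by simp
      then show ?thesis by blast
    next
      case greater
      then have "k = int (Suc (nat (k - 1)))" by simp
      then show ?thesis by blast
    qed simp
    then show ?thesis by blast
  qed
  ultimately have "phi t = \<i> * t + (s + s)"
    unfolding phi_def by (metis infsumI)
  moreover have "z / (4 * c) + z / (4 * c) = z / (2 * c)" for z c :: complex
    by (cases "c = 0") (auto simp: field_simps)
  ultimately show ?thesis by (simp add: s_def)
qed

lemma norm_phi_diff_le:
  "norm (phi (- (x + h) / (2 * pi)) - phi (- x / (2 * pi)))
     \<le> \<bar>h\<bar> + norm (theta_series (x + h) - theta_series x)"
proof -
  have arg: "- 2 * pi * (- y / (2 * pi)) = y" for y by simp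
  have "phi (- (x + h) / (2 * pi)) - phi (- x / (2 * pi))
      = - \<i> * complex_of_real (h / (2 * pi))
        - (theta_series (x + h) - theta_series x) / (2 * pi\<^sup>2)"
    unfolding phi_eq_theta_series arg by (simp add: field_simps)
  also have "norm \<dots> \<le> norm (- \<i> * complex_of_real (h / (2 * pi)))
      + norm ((theta_series (x + h) - theta_series x) / (2 * pi\<^sup>2))"
    by (rule norm_triangle_ineq4)
  also have "norm (- \<i> * complex_of_real (h / (2 * pi))) = \<bar>h\<bar> / (2 * pi)"
    by (simp add: norm_mult norm_divide)
  also have "\<dots> \<le> \<bar>h\<bar> / 1" using pi_gt3 by (intro divide_left_mono) auto
  also have "norm ((theta_series (x + h) - theta_series x) / (2 * pi\<^sup>2))
      = norm (theta_series (x + h) - theta_series x) / (2 * pi\<^sup>2)"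
    by (simp add: norm_divide norm_mult norm_power)
  also have "\<dots> \<le> norm (theta_series (x + h) - theta_series x) / 1"
  proof (rule divide_left_mono)
    have "1 * 1 \<le> pi * pi" using pi_gt3 by (intro mult_mono) auto
    then show "1 \<le> 2 * pi\<^sup>2" by (simp add: power2_eq_square)
  qed auto
  finally show ?thesis by simp
qed

lemma norm_phi_diff_le_weyl:
  fixes x h A B :: real
  assumes "\<And>n y. y \<in> closed_segment x (x + h) \<Longrightarrow> norm (weyl_sum n y) \<le> A * real n + B"
    and "0 \<le> A" and "0 \<le> B" and "\<bar>h\<bar> \<le> 1"
  shows "norm (phi (- (x + h) / (2 * pi)) - phi (- x / (2 * pi)))
    \<le> \<bar>h\<bar> + 22 * (A * sqrt \<bar>h\<bar> + B * \<bar>h\<bar>)"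
  by (rule order_trans[OF norm_phi_diff_le add_left_mono[OF norm_theta_series_diff_le]]) (fact assms)+

lemma abs_diff_le_of_mem_closed_segment:
  fixes x h y :: real
  assumes "y \<in> closed_segment x (x + h)"
  shows "\<bar>y - x\<bar> \<le> \<bar>h\<bar>"
  using assms by (auto simp: closed_segment_eq_real_ivl split: if_splits)

text \<open>The whole segment stays within 2/q^2 of p/q, so Weyl's inequality supplies A = C
  q^(\<epsilon>-1/2) and B = C q^(\<epsilon>+1/2). As sqrt |h| \<le> 1/q, the terms |h| and B |h|
  are absorbed by multiples of q^(\<epsilon>-1/2) sqrt |h|.\<close>

lemma norm_phi_diff_le_of_rational_approx:
  fixes \<epsilon> :: real
  assumes eps: "\<epsilon> > 0"
  obtains C where "C > 0"
    "\<And>p q x h. coprime p (int q) \<Longrightarrow> q > 0 \<Longrightarrow> \<bar>x - of_int p / real q\<bar> \<le> 1 / (real q)\<^sup>2 \<Longrightarrow>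
       \<bar>h\<bar> \<le> 1 / (real q)\<^sup>2 \<Longrightarrow>
       norm (phi (- (x + h) / (2 * pi)) - phi (- x / (2 * pi))) \<le> C * real q powr (\<epsilon> - 1/2) * sqrt \<bar>h\<bar>"
proof -
  obtain C where C: "C > 0"
    "\<And>p q y n. coprime p (int q) \<Longrightarrow> q > 0 \<Longrightarrow> \<bar>y - of_int p / real q\<bar> \<le> 2 / (real q)\<^sup>2 \<Longrightarrow>
       norm (weyl_sum n y) \<le> C * real q powr \<epsilon> * (real n / sqrt (real q) + sqrt (real q))"
    using weyl_inequality[OF eps] by blast
  show thesis
  proof (rule that)
    show "1 + 44 * C > 0" using C by simp
    fix p :: int and q :: nat and x h :: real
    assume pq: "coprime p (int q)" "q > 0"
      and x: "\<bar>x - of_int p / real q\<bar> \<le> 1 / (real q)\<^sup>2" and h: "\<bar>h\<bar> \<le> 1 / (real q)\<^sup>2"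
    define r where "r = sqrt (real q)"
    have r: "r \<ge> 1" "real q = r\<^sup>2" using pq by (auto simp: r_def)
    define E where "E = real q powr \<epsilon>"
    have E: "E \<ge> 1" unfolding E_def using pq eps by (intro ge_one_powr_ge_zero) auto
    have E_div: "real q powr (\<epsilon> - 1/2) = E / r"
      unfolding E_def r_def by (simp add: powr_diff powr_half_sqrt)
    define s where "s = sqrt \<bar>h\<bar>"
    have s: "s \<ge> 0" "\<bar>h\<bar> = s * s" by (auto simp: s_def)
    have sq: "s * r \<le> 1 / r"
    proof -
      have "s \<le> sqrt (1 / (real q)\<^sup>2)" unfolding s_def using h by (rule real_sqrt_le_mono)
      then have "s \<le> 1 / (r * r)" using r by (simp add: real_sqrt_divide power2_eq_square)
      then show ?thesis using r by (simp add: field_simps)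
    qed
    have "norm (phi (- (x + h) / (2 * pi)) - phi (- x / (2 * pi)))
        \<le> \<bar>h\<bar> + 22 * ((C * E / r) * sqrt \<bar>h\<bar> + (C * E * r) * \<bar>h\<bar>)"
    proof (rule norm_phi_diff_le_weyl)
      fix n :: nat and y assume "y \<in> closed_segment x (x + h)"
      then have "\<bar>y - x\<bar> \<le> \<bar>h\<bar>" by (rule abs_diff_le_of_mem_closed_segment)
      then have "\<bar>y - of_int p / real q\<bar> \<le> 1 / (real q)\<^sup>2 + 1 / (real q)\<^sup>2" using x h by linarith
      then have "\<bar>y - of_int p / real q\<bar> \<le> 2 / (real q)\<^sup>2" by simp
      from C(2)[OF pq this, of n]
      show "norm (weyl_sum n y) \<le> C * E / r * real n + C * E * r"
        by (simp add: E_def r_def algebra_simps)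
    next
      have "1 / (real q)\<^sup>2 \<le> 1" using pq by simp
      then show "\<bar>h\<bar> \<le> 1" using h by linarith
    qed (use C E r in auto)
    also have "\<dots> = s * s + 22 * (C * E / r * s + C * E * (s * r) * s)"
      unfolding s_def[symmetric] unfolding s(2) by (simp add: algebra_simps)
    also have "\<dots> \<le> E / r * s + 22 * (C * E / r * s + C * E * (1 / r) * s)"
    proof (intro add_mono mult_left_mono mult_right_mono sq)
      have "s * 1 \<le> s * r" using s r by (intro mult_left_mono) auto
      also have "\<dots> \<le> 1 / r" by (rule sq)
      also have "\<dots> \<le> E / r" using E r by (intro divide_right_mono) auto
      finally show "s \<le> E / r" by simp
    qed (use C E s r in auto)
    also have "\<dots> = (1 + 44 * C) * (E / r) * s" by (simp add: algebra_simps)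
    finally show "norm (phi (- (x + h) / (2 * pi)) - phi (- x / (2 * pi)))
        \<le> (1 + 44 * C) * real q powr (\<epsilon> - 1/2) * sqrt \<bar>h\<bar>"
      by (simp add: E_div s_def)
  qed
qed

section \<open>Dirichlet approximation and the pointwise regularity bound\<close>

lemma Dirichlet_approx_nat:
  fixes x :: real
  assumes "Q > 0"
  obtains p q where "coprime p (int q)" "0 < q" "q \<le> Q" "\<bar>real q * x - of_int p\<bar> < 1 / real Q"
proof -
  obtain h k where hk: "coprime h k" "0 < k" "k \<le> int Q" "\<bar>of_int k * x - of_int h\<bar> < 1 / real Q"
    using Dirichlet_approx_coprime[OF assms] by blast
  then show thesis by (intro that[of h "nat k"]) auto
qed

text \<open>The denominator produced here plays the role of the next convergent after \<open>p / q\<close>.\<close>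
lemma exists_next_rational_approx:
  fixes y R :: real and p :: int and q :: nat
  assumes cop: "coprime p (int q)" and q: "q > 0"
    and R: "R > 0" "\<bar>real q * y - of_int p\<bar> = 1 / R" and qR: "real q \<le> 2 * R"
  obtains p' q' where "coprime p' (int q')" "q' > 0" "\<bar>y - of_int p' / real q'\<bar> \<le> 1 / (real q')\<^sup>2"
    "R / 2 \<le> real q'" "real q' \<le> 6 * R"
proof -
  \<comment> \<open>With Q \<ge> 4 R the error satisfies q |q' y - p'| \<le> (2 R) / (4 R) = 1/2,
    and 1/Q < 1/R prevents p'/q' from being p/q again.\<close>
  define Q where "Q = nat \<lceil>4 * R\<rceil>"
  have Q: "4 * R \<le> real Q" "real Q \<le> 4 * R + 1"
    unfolding Q_def using R by (auto simp: of_nat_nat intro: less_imp_le)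
  have Q0: "real Q > 0" using Q R by linarith
  have "1 \<le> 2 * R" using q qR by linarith
  then obtain p' q' where *: "coprime p' (int q')" "0 < q'" "q' \<le> Q"
      "\<bar>real q' * y - of_int p'\<bar> < 1 / real Q"
    using Dirichlet_approx_nat[of Q y] Q0 by auto
  have ne: "p * int q' \<noteq> p' * int q"
  proof
    assume eq: "p * int q' = p' * int q"
    have "int q dvd p * int q'" unfolding eq by simp
    then have "int q dvd int q'"
      using cop by (simp add: coprime_commute coprime_dvd_mult_right_iff)
    moreover have "int q' dvd p' * int q" unfolding eq[symmetric] by simp
    then have "int q' dvd int q"
      using *(1) by (simp add: coprime_commute coprime_dvd_mult_right_iff)
    ultimately have "q = q'" by (simp add: dvd_antisym)
    then have "1 / R < 1 / real Q" using eq q R *(4) by simp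
    then show False using Q R by (simp add: field_simps)
  qed
  \<comment> \<open>A nonzero determinant has size at least 1. One of the two terms bounding it is
    at most 1/2, so the other, q'/R, is at least 1/2.\<close>
  have "1 \<le> \<bar>p * int q' - p' * int q\<bar>" using ne by linarith
  then have "1 \<le> \<bar>real_of_int (p * int q' - p' * int q)\<bar>" by linarith
  also have "real_of_int (p * int q' - p' * int q)
      = real q * (real q' * y - of_int p') - real q' * (real q * y - of_int p)"
    by (simp add: algebra_simps)
  also have "\<bar>\<dots>\<bar> \<le> \<bar>real q * (real q' * y - of_int p')\<bar> + \<bar>real q' * (real q * y - of_int p)\<bar>"
    by (rule abs_triangle_ineq4)
  also have "\<dots> = real q * \<bar>real q' * y - of_int p'\<bar> + real q' / R"
    using R by (simp add: abs_mult)
  also have "real q * \<bar>real q' * y - of_int p'\<bar> \<le> (2 * R) * (1 / (4 * R))"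
  proof (rule mult_mono)
    have "\<bar>real q' * y - of_int p'\<bar> \<le> 1 / real Q" using *(4) by simp
    also have "\<dots> \<le> 1 / (4 * R)" using Q R by (intro divide_left_mono) auto
    finally show "\<bar>real q' * y - of_int p'\<bar> \<le> 1 / (4 * R)" .
  qed (use qR R in auto)
  also have "\<dots> = 1 / 2" using R by simp
  finally have "1 / 2 \<le> real q' / R" by linarith
  then have "R / 2 \<le> real q'" using R by (simp add: field_simps)
  moreover have "real q' \<le> 6 * R" using *(3) Q \<open>1 \<le> 2 * R\<close> by linarith
  moreover have "\<bar>y - of_int p' / real q'\<bar> \<le> 1 / (real q')\<^sup>2"
  proof -
    have "\<bar>y - of_int p' / real q'\<bar> = \<bar>real q' * y - of_int p'\<bar> / real q'"
      using *(2) by (subst abs_div_pos) (auto simp: field_simps)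
    also have "\<dots> \<le> (1 / real Q) / real q'" using *(2,4) by (intro divide_right_mono) auto
    also have "\<dots> \<le> (1 / real q') / real q'"
      using *(2,3) by (intro divide_right_mono divide_left_mono) auto
    finally show ?thesis by (simp add: power2_eq_square)
  qed
  ultimately show thesis using * that by blast
qed

text \<open>Since q |h| is at most half of |q x - p|, every point y of the segment keeps |q y - p|
  comparable to 1/R and so has an approximation whose denominator is comparable to R. That
  denominator varies with y, but Weyl's inequality at scale R holds uniformly, and 1 \<le> 2 R sqrt
  |h| lets the B |h| term dominate.\<close>

lemma norm_phi_diff_le_off_rational:
  fixes \<epsilon> :: real
  assumes eps: "\<epsilon> > 0" "\<epsilon> \<le> 1"
  obtains C where "C > 0"
    "\<And>p q x h R. coprime p (int q) \<Longrightarrow> q > 0 \<Longrightarrow> R > 0 \<Longrightarrow> \<bar>real q * x - of_int p\<bar> = 1 / R \<Longrightarrow>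
       real q \<le> R \<Longrightarrow> 2 * (real q * \<bar>h\<bar>) \<le> 1 / R \<Longrightarrow> \<bar>h\<bar> \<le> 1 \<Longrightarrow> 1 \<le> 2 * R * sqrt \<bar>h\<bar> \<Longrightarrow>
       norm (phi (- (x + h) / (2 * pi)) - phi (- x / (2 * pi))) \<le> C * R powr (1/2 + \<epsilon>) * \<bar>h\<bar>"
proof -
  obtain C where C: "C > 0"
    "\<And>p q y n. coprime p (int q) \<Longrightarrow> q > 0 \<Longrightarrow> \<bar>y - of_int p / real q\<bar> \<le> 2 / (real q)\<^sup>2 \<Longrightarrow>
       norm (weyl_sum n y) \<le> C * real q powr \<epsilon> * (real n / sqrt (real q) + sqrt (real q))"
    using weyl_inequality[OF eps(1)] by blast
  show thesis
  proof (rule that)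
    show "1 + 22 * (96 * C) > 0" using C by simp
    fix p :: int and q :: nat and x h R :: real
    assume pq: "coprime p (int q)" "q > 0" and R: "R > 0" "\<bar>real q * x - of_int p\<bar> = 1 / R"
      and qR: "real q \<le> R" and h: "2 * (real q * \<bar>h\<bar>) \<le> 1 / R" "\<bar>h\<bar> \<le> 1" "1 \<le> 2 * R * sqrt \<bar>h\<bar>"
    define E where "E = R powr \<epsilon>"
    define r where "r = sqrt R"
    define s where "s = sqrt \<bar>h\<bar>"
    have R1: "R \<ge> 1" using pq qR by linarith
    have r: "r \<ge> 1" "R = r * r" using R1 by (auto simp: r_def)
    have E: "E \<ge> 1" unfolding E_def using R1 eps by (intro ge_one_powr_ge_zero) auto
    have s: "s \<ge> 0" "\<bar>h\<bar> = s * s" by (auto simp: s_def)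
    have "norm (phi (- (x + h) / (2 * pi)) - phi (- x / (2 * pi)))
        \<le> \<bar>h\<bar> + 22 * ((24 * C * E / r) * sqrt \<bar>h\<bar> + (48 * C * E * r) * \<bar>h\<bar>)"
    proof (rule norm_phi_diff_le_weyl)
      fix n :: nat and y assume "y \<in> closed_segment x (x + h)"
      then have yx: "\<bar>y - x\<bar> \<le> \<bar>h\<bar>" by (rule abs_diff_le_of_mem_closed_segment)
      define d where "d = \<bar>real q * y - of_int p\<bar>"
      have "real q * \<bar>y - x\<bar> \<le> real q * \<bar>h\<bar>" using yx by (intro mult_left_mono) auto
      then have "\<bar>real q * y - real q * x\<bar> \<le> (1/2) * (1 / R)"
        using h by (simp add: abs_mult right_diff_distrib[symmetric])
      then have d: "(1/2) * (1 / R) \<le> d" "d \<le> (3/2) * (1 / R)"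
        using R(2) unfolding d_def by linarith+
      have d0: "d > 0" using d(1) R(1) by (auto intro: less_le_trans[rotated])
      \<comment> \<open>\<open>D\<close> plays the part of \<open>R\<close> at the point
        \<open>y\<close>; it lies between 2R/3 and 2R.\<close>
      define D where "D = 1 / d"
      have Rd: "D \<le> 2 * R" "2 * R / 3 \<le> D"
        using d d0 R by (auto simp: D_def field_simps)
      have "\<bar>real q * y - of_int p\<bar> = 1 / D" by (simp add: d_def D_def)
      moreover have "real q \<le> 2 * D" using qR Rd R by linarith
      moreover have "D > 0" using d0 by (simp add: D_def)
      ultimately obtain p' q' where *: "coprime p' (int q')" "q' > 0"
          "\<bar>y - of_int p' / real q'\<bar> \<le> 1 / (real q')\<^sup>2" "D / 2 \<le> real q'" "real q' \<le> 6 * D"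
        using exists_next_rational_approx[OF pq] by metis
      have q': "R / 4 \<le> real q'" "real q' \<le> 12 * R" using *(4,5) Rd R(1) by linarith+
      have "1 / (real q')\<^sup>2 \<le> 2 / (real q')\<^sup>2" by (intro divide_right_mono) auto
      then have "norm (weyl_sum n y) \<le> C * real q' powr \<epsilon> * (real n / sqrt (real q') + sqrt (real q'))"
        using * by (intro C(2)) auto
      also have "\<dots> \<le> C * (12 * E) * (real n / (r / 2) + 4 * r)"
      proof (intro mult_mono add_mono divide_left_mono)
        have "real q' powr \<epsilon> \<le> (12 * R) powr \<epsilon>"
          using q' eps by (intro powr_mono2) auto
        also have "\<dots> = 12 powr \<epsilon> * E" using R by (simp add: powr_mult E_def)
        also have "\<dots> \<le> 12 powr 1 * E" using E eps by (intro mult_right_mono powr_mono) auto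
        finally show "real q' powr \<epsilon> \<le> 12 * E" by simp
        have "sqrt (R / 4) \<le> sqrt (real q')" using q' by simp
        then show "r / 2 \<le> sqrt (real q')" by (simp add: real_sqrt_divide r_def)
        have "sqrt (real q') \<le> sqrt (16 * R)" using q' R by simp
        then show "sqrt (real q') \<le> 4 * r" by (simp add: real_sqrt_mult r_def)
      qed (use C E r *(2) in auto)
      finally show "norm (weyl_sum n y) \<le> 24 * C * E / r * real n + 48 * C * E * r"
        using r by (simp add: algebra_simps)
    qed (use h C E r in auto)
    also have "\<dots> = 1 * \<bar>h\<bar> + 22 * (24 * C * E * (s / r) + 48 * C * E * r * \<bar>h\<bar>)"
      by (simp add: s_def)
    also have "\<dots> \<le> (E * r) * \<bar>h\<bar> + 22 * (24 * C * E * (2 * r * \<bar>h\<bar>) + 48 * C * E * r * \<bar>h\<bar>)"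
    proof (intro add_mono mult_left_mono mult_right_mono order_refl)
      show "1 \<le> E * r" using E r mult_mono[of 1 E 1 r] by auto
      have "s * 1 \<le> s * (2 * R * s)"
        using h(3) s(1) unfolding s_def[symmetric] by (rule mult_left_mono)
      also have "\<dots> = 2 * r * \<bar>h\<bar> * r" unfolding s(2) r(2) by (simp add: mult_ac)
      finally show "s / r \<le> 2 * r * \<bar>h\<bar>" using r(1) by (simp add: divide_le_eq)
    qed (use C E r in auto)
    also have "\<dots> = (1 + 22 * (96 * C)) * (E * r) * \<bar>h\<bar>" by (simp add: algebra_simps)
    also have "E * r = R powr (1/2 + \<epsilon>)"
      using R by (simp add: E_def r_def powr_add powr_half_sqrt)
    finally show "norm (phi (- (x + h) / (2 * pi)) - phi (- x / (2 * pi)))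
        \<le> (1 + 22 * (96 * C)) * R powr (1/2 + \<epsilon>) * \<bar>h\<bar>" .
  qed
qed

text \<open>Both cases lead to the same exponent: near p/q the Diophantine bound gives q^(-1/2) at
  most a multiple of |h|^(1/(2\<mu>)), to be multiplied by |h|^(1/2); away from it R is at most a
  multiple of |h|^(1/\<mu>-1), to be used in R^(1/2) |h|. The remaining factors cost at most
  |h|^(-\<epsilon>).\<close>

lemma norm_phi_diff_le_of_diophantine:
  fixes x c \<mu> \<epsilon> :: real
  assumes c: "c > 0" and mu: "\<mu> > 1" and eps: "\<epsilon> > 0" "\<epsilon> \<le> 1"
    and x: "\<And>p q. coprime p (int q) \<Longrightarrow> q > 0 \<Longrightarrow> c * real q powr (- \<mu>) \<le> \<bar>x - of_int p / real q\<bar>"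
  obtains C where "C > 0"
    "\<And>h. \<bar>h\<bar> \<le> 1 \<Longrightarrow> norm (phi (- (x + h) / (2 * pi)) - phi (- x / (2 * pi)))
       \<le> C * \<bar>h\<bar> powr (1/2 + 1 / (2 * \<mu>) - \<epsilon>)"
proof -
  obtain C1 where C1: "C1 > 0"
    "\<And>p q x h. coprime p (int q) \<Longrightarrow> q > 0 \<Longrightarrow> \<bar>x - of_int p / real q\<bar> \<le> 1 / (real q)\<^sup>2 \<Longrightarrow>
       \<bar>h\<bar> \<le> 1 / (real q)\<^sup>2 \<Longrightarrow>
       norm (phi (- (x + h) / (2 * pi)) - phi (- x / (2 * pi))) \<le> C1 * real q powr (\<epsilon> - 1/2) * sqrt \<bar>h\<bar>"
    using norm_phi_diff_le_of_rational_approx[OF eps(1)] by blast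
  obtain C2 where C2: "C2 > 0"
    "\<And>p q x h R. coprime p (int q) \<Longrightarrow> q > 0 \<Longrightarrow> R > 0 \<Longrightarrow> \<bar>real q * x - of_int p\<bar> = 1 / R \<Longrightarrow>
       real q \<le> R \<Longrightarrow> 2 * (real q * \<bar>h\<bar>) \<le> 1 / R \<Longrightarrow> \<bar>h\<bar> \<le> 1 \<Longrightarrow> 1 \<le> 2 * R * sqrt \<bar>h\<bar> \<Longrightarrow>
       norm (phi (- (x + h) / (2 * pi)) - phi (- x / (2 * pi))) \<le> C2 * R powr (1/2 + \<epsilon>) * \<bar>h\<bar>"
    using norm_phi_diff_le_off_rational[OF eps] by blast
  define A1 where "A1 = C1 * (2 / c) powr (1 / (2 * \<mu>))"
  define A2 where "A2 = C2 * (1 / c) powr ((1/2 + \<epsilon>) / \<mu>)"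
  let ?e = "1/2 + 1 / (2 * \<mu>) - \<epsilon>"
  show thesis
  proof (rule that)
    show "A1 + A2 > 0" using C1(1) C2(1) c by (simp add: A1_def A2_def add_pos_pos)
    fix h :: real
    assume h: "\<bar>h\<bar> \<le> 1"
    let ?D = "norm (phi (- (x + h) / (2 * pi)) - phi (- x / (2 * pi)))"
    have A12: "A1 \<ge> 0" "A2 \<ge> 0" using C1(1) C2(1) by (auto simp: A1_def A2_def)
    have "?D \<le> A1 * \<bar>h\<bar> powr ?e \<or> ?D \<le> A2 * \<bar>h\<bar> powr ?e"
    proof (cases "h = 0")
      case False
      define t where "t = \<bar>h\<bar>"
      have t: "0 < t" "t \<le> 1" using False h by (auto simp: t_def)
      define s where "s = sqrt t"
      have s: "0 < s" "s \<le> 1" "s\<^sup>2 = t" using t by (auto simp: s_def)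
      \<comment> \<open>Dirichlet's theorem is applied at scale |h|^(-1/2), so that q \<le> Q
        ensures |h| \<le> 1/q^2.\<close>
      define Q where "Q = nat \<lfloor>1 / s\<rfloor>"
      have s1: "1 \<le> 1 / s" using s by simp
      have Q: "real Q \<le> 1 / s" "1 / s < real Q + 1"
        unfolding Q_def using s by (auto simp: of_nat_nat)
      have Q0: "Q > 0" unfolding Q_def using s1 by (simp add: zero_less_nat_eq)
      then have Q1: "real Q \<ge> 1" by simp
      obtain p q where pq: "coprime p (int q)" "0 < q" "q \<le> Q" "\<bar>real q * x - of_int p\<bar> < 1 / real Q"
        using Dirichlet_approx_nat[OF Q0] by metis
      have q1: "real q \<ge> 1" "real q \<le> real Q" using pq by auto
      have qs: "real q \<le> 1 / s" using q1 Q by linarith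
      define d where "d = \<bar>real q * x - of_int p\<bar>"
      have d_eq: "\<bar>x - of_int p / real q\<bar> = d / real q"
        unfolding d_def using pq(2) by (subst abs_div_pos) (auto simp: field_simps)
      have d_ge: "c * real q powr (- \<mu>) \<le> d / real q" using x[OF pq(1,2)] by (simp add: d_eq)
      have "0 < c * real q powr (- \<mu>)" using c pq by simp
      then have "0 < d / real q" using d_ge by linarith
      then have d0: "d > 0" using pq by (simp add: zero_less_divide_iff)
      have dQ: "d < 1 / real Q" using pq by (simp add: d_def)
      have "1 / real Q \<le> 1 / real q" using pq by (intro divide_left_mono) auto
      then have dq: "d \<le> 1 / real q" using dQ by linarith
      show ?thesis
      \<comment> \<open>Either \<open>h\<close> is at least comparable to \<open>|x - p/q|\<close>, which bounds \<open>q\<close> from below, or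
        \<open>[x, x + h]\<close> stays away from \<open>p/q\<close> and the next convergent, of size \<open>R\<close>, takes over.\<close>
      proof (cases "d / real q \<le> 2 * t")
        case True
        have "?D \<le> C1 * real q powr (\<epsilon> - 1/2) * sqrt \<bar>h\<bar>"
        proof (rule C1(2)[OF pq(1,2)])
          have "d / real q \<le> (1 / real q) / real q" using dq by (intro divide_right_mono) auto
          then show "\<bar>x - of_int p / real q\<bar> \<le> 1 / (real q)\<^sup>2"
            unfolding d_eq by (simp add: power2_eq_square)
          have "s \<le> 1 / real q" using qs s q1 by (simp add: field_simps)
          then have "s\<^sup>2 \<le> (1 / real q)\<^sup>2" using s by (intro power_mono) auto
          then show "\<bar>h\<bar> \<le> 1 / (real q)\<^sup>2" by (simp add: s t_def[symmetric] power_divide)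
        qed
        also have "\<dots> = C1 * (real q powr \<epsilon> * real q powr (- 1/2) * t powr (1/2))"
          using t by (simp add: powr_diff powr_minus_divide powr_half_sqrt t_def)
        also have "\<dots> \<le> C1 * (t powr (- \<epsilon>) * ((2 / c) powr (1 / (2 * \<mu>)) * t powr (1 / (2 * \<mu>))) * t powr (1/2))"
        proof (intro mult_left_mono mult_right_mono mult_mono)
          have "real q powr \<epsilon> \<le> (1 / s) powr \<epsilon>" using qs eps by (intro powr_mono2) auto
          also have "1 / s = t powr (- 1/2)"
            unfolding s_def using t by (simp add: powr_minus_divide powr_half_sqrt)
          also have "(t powr (- 1/2)) powr \<epsilon> = t powr (- 1/2 * \<epsilon>)" by (rule powr_powr)
          also have "\<dots> \<le> t powr (- \<epsilon>)" using t eps by (intro powr_mono') auto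
          finally show "real q powr \<epsilon> \<le> t powr (- \<epsilon>)" .
          have "c * real q powr (- \<mu>) \<le> 2 * t" using d_ge True by linarith
          then have le: "real q powr (- \<mu>) \<le> 2 / c * t" using c by (simp add: field_simps)
          have "real q powr (- 1/2) = (real q powr (- \<mu>)) powr (1 / (2 * \<mu>))"
            using mu by (simp add: powr_powr)
          also have "\<dots> \<le> (2 / c * t) powr (1 / (2 * \<mu>))"
            using le mu by (intro powr_mono2) auto
          also have "\<dots> = (2 / c) powr (1 / (2 * \<mu>)) * t powr (1 / (2 * \<mu>))"
            using c t by (intro powr_mult)
          finally show "real q powr (- 1/2) \<le> (2 / c) powr (1 / (2 * \<mu>)) * t powr (1 / (2 * \<mu>))" .
        qed (use C1(1) in auto)
        also have "\<dots> = A1 * (t powr (1/2) * t powr (1 / (2 * \<mu>)) * t powr (- \<epsilon>))"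
          by (simp add: A1_def mult_ac)
        also have "t powr (1/2) * t powr (1 / (2 * \<mu>)) * t powr (- \<epsilon>) = t powr ?e"
          by (simp only: powr_add[symmetric] diff_conv_add_uminus)
        finally show ?thesis by (simp add: t_def)
      next
        case False
        define R where "R = 1 / d"
        have R: "R > 0" using d0 by (simp add: R_def)
        have RQ: "real Q \<le> R"
          using dQ d0 Q1 unfolding R_def by (simp add: field_simps)
        have qt: "2 * (real q * t) \<le> 1 / R" using False q1 by (simp add: R_def field_simps)
        have "?D \<le> C2 * R powr (1/2 + \<epsilon>) * \<bar>h\<bar>"
        proof (rule C2(2)[OF pq(1,2) R])
          show "\<bar>real q * x - of_int p\<bar> = 1 / R" by (simp add: R_def d_def)
          show "real q \<le> R" using q1 RQ by linarith
          show "2 * (real q * \<bar>h\<bar>) \<le> 1 / R" using qt by (simp add: t_def)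
          \<comment> \<open>Rounding costs a factor 2: 1/s < Q + 1 \<le> 2 Q \<le> 2 R.\<close>
          have "1 / s \<le> 2 * R" using Q Q1 RQ by linarith
          then show "1 \<le> 2 * R * sqrt \<bar>h\<bar>"
            using s(1) by (simp add: divide_le_eq t_def[symmetric] s_def[symmetric])
        qed (fact h)
        also have "\<dots> \<le> C2 * ((1 / c) powr ((1/2 + \<epsilon>) / \<mu>) * t powr ((1 / \<mu> - 1) * (1/2 + \<epsilon>))) * t"
        proof (unfold t_def[symmetric], intro mult_right_mono mult_left_mono)
          have R1: "R \<le> (1 / c) * real q powr (\<mu> - 1)"
          proof -
            have "c * (real q powr (- \<mu>) * real q) \<le> d" using d_ge q1 by (simp add: field_simps)
            moreover have "real q powr (- \<mu>) * real q = real q powr (1 - \<mu>)"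
              using q1 by (simp add: powr_diff powr_minus_divide)
            ultimately have "c * real q powr (1 - \<mu>) \<le> d" by simp
            then have "1 / d \<le> 1 / (c * real q powr (1 - \<mu>))"
              using c q1 d0 by (intro divide_left_mono) auto
            also have "\<dots> = (1 / c) * real q powr (\<mu> - 1)"
              using q1 by (simp add: powr_diff)
            finally show ?thesis by (simp add: R_def)
          qed
          have R2: "R \<le> 1 / (real q * t)"
          proof -
            have "real q * t > 0" using q1 t by simp
            moreover have "real q * t * R \<le> 1" using qt R \<open>real q * t > 0\<close> by (simp add: field_simps)
            ultimately show ?thesis by (simp add: field_simps)
          qed
          \<comment> \<open>One factor R is bounded by the Diophantine condition and the remaining
            power by R \<le> 1/(q t); in the product the powers of q cancel.\<close>
          have "R powr \<mu> = R * R powr (\<mu> - 1)" using R by (simp add: powr_diff)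
          also have "\<dots> \<le> ((1 / c) * real q powr (\<mu> - 1)) * (1 / (real q * t)) powr (\<mu> - 1)"
            using R1 R2 R mu c by (intro mult_mono powr_mono2) auto
          also have "\<dots> = (1 / c) * (real q * (1 / (real q * t))) powr (\<mu> - 1)"
            using q1 t by (simp add: powr_mult[symmetric])
          also have "real q * (1 / (real q * t)) = 1 / t" using q1 by simp
          also have "(1 / t) powr (\<mu> - 1) = t powr (1 - \<mu>)"
            using t by (simp add: powr_divide powr_diff)
          finally have Rmu: "R powr \<mu> \<le> (1 / c) * t powr (1 - \<mu>)" .
          have "R powr (1/2 + \<epsilon>) = (R powr \<mu>) powr ((1/2 + \<epsilon>) / \<mu>)"
            using mu by (simp add: powr_powr)
          also have "\<dots> \<le> ((1 / c) * t powr (1 - \<mu>)) powr ((1/2 + \<epsilon>) / \<mu>)"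
            using Rmu mu eps by (intro powr_mono2) auto
          also have "\<dots> = (1 / c) powr ((1/2 + \<epsilon>) / \<mu>) * (t powr (1 - \<mu>)) powr ((1/2 + \<epsilon>) / \<mu>)"
            using c by (intro powr_mult)
          also have "(t powr (1 - \<mu>)) powr ((1/2 + \<epsilon>) / \<mu>) = t powr ((1 / \<mu> - 1) * (1/2 + \<epsilon>))"
          proof -
            have "(1 - \<mu>) * ((1/2 + \<epsilon>) / \<mu>) = (1 / \<mu> - 1) * (1/2 + \<epsilon>)"
              using mu by (simp add: field_simps)
            then show ?thesis by (simp only: powr_powr)
          qed
          finally show "R powr (1/2 + \<epsilon>)
              \<le> (1 / c) powr ((1/2 + \<epsilon>) / \<mu>) * t powr ((1 / \<mu> - 1) * (1/2 + \<epsilon>))" .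
        qed (use C2(1) t in auto)
        also have "\<dots> = A2 * (t powr ((1 / \<mu> - 1) * (1/2 + \<epsilon>)) * t powr 1)"
          using t by (simp add: A2_def)
        also have "t powr ((1 / \<mu> - 1) * (1/2 + \<epsilon>)) * t powr 1 = t powr ((1 / \<mu> - 1) * (1/2 + \<epsilon>) + 1)"
          by (rule powr_add[symmetric])
        also have "A2 * \<dots> \<le> A2 * t powr ?e"
        proof (intro mult_left_mono powr_mono')
          have "(1 / \<mu> - 1) * (1/2 + \<epsilon>) + 1 = ?e + \<epsilon> / \<mu>" by (simp add: field_simps)
          moreover have "\<epsilon> / \<mu> \<ge> 0" using eps mu by simp
          ultimately show "?e \<le> (1 / \<mu> - 1) * (1/2 + \<epsilon>) + 1" by linarith
        qed (use t A12 in auto)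
        finally show ?thesis by (simp add: t_def)
      qed
    qed simp
    moreover have "A1 * \<bar>h\<bar> powr ?e \<le> (A1 + A2) * \<bar>h\<bar> powr ?e" "A2 * \<bar>h\<bar> powr ?e \<le> (A1 + A2) * \<bar>h\<bar> powr ?e"
      using A12 by (auto intro!: mult_right_mono)
    ultimately show "?D \<le> (A1 + A2) * \<bar>h\<bar> powr ?e" by linarith
  qed
qed

section \<open>Null sets of Hausdorff measures\<close>

lemma hausdorff_pre_mono: "A \<subseteq> B \<Longrightarrow> hausdorff_pre s \<delta> A \<le> hausdorff_pre s \<delta> B"
  unfolding hausdorff_pre_def by (intro INF_superset_mono) auto

lemma hausdorff_measure_mono: "A \<subseteq> B \<Longrightarrow> hausdorff_measure s A \<le> hausdorff_measure s B"
  unfolding hausdorff_measure_def by (intro SUP_mono') (auto intro: hausdorff_pre_mono)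

lemma hausdorff_measure_eq_0_mono:
  "A \<subseteq> B \<Longrightarrow> hausdorff_measure s B = 0 \<Longrightarrow> hausdorff_measure s A = 0"
  using hausdorff_measure_mono[of A B s] by simp

lemma hausdorff_dim_mono: "A \<subseteq> B \<Longrightarrow> hausdorff_dim A \<le> hausdorff_dim B"
  unfolding hausdorff_dim_def by (intro Inf_superset_mono) (auto dest: hausdorff_measure_eq_0_mono)

lemma hausdorff_dim_le:
  assumes "\<And>s. s > d \<Longrightarrow> s > 0 \<Longrightarrow> hausdorff_measure s A = 0" and "d \<ge> 0"
  shows "hausdorff_dim A \<le> ereal d"
proof (rule ereal_le_epsilon2)
  fix e :: real assume "e > 0"
  then have "hausdorff_dim A \<le> ereal (d + e)"
    unfolding hausdorff_dim_def using assms by (intro Inf_lower) auto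
  then show "hausdorff_dim A \<le> ereal d + ereal e" by simp
qed

text \<open>Small sums force small pieces: if the s-th powers of the diameters add up to at most
  \<delta>^s, every diameter is at most \<delta>. Aiming at the minimum of e and \<delta>^s thus
  yields covers admissible at scale \<delta>.\<close>

lemma hausdorff_measure_eq_0I:
  assumes s: "s > 0"
    and cover: "\<And>e. e > 0 \<Longrightarrow> \<exists>U :: nat \<Rightarrow> 'a::metric_space set. A \<subseteq> (\<Union>i. U i) \<and> (\<forall>i. bounded (U i)) \<and>
      (\<Sum>i. ennreal (diameter (U i) powr s)) \<le> ennreal e"
  shows "hausdorff_measure s A = 0"
proof -
  have le: "hausdorff_pre s \<delta> A \<le> 0 + ennreal e" if \<delta>: "\<delta> > 0" and e: "e > 0" for \<delta> e
  proof -
    define e' where "e' = min e (\<delta> powr s)"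
    have "e' > 0" using e \<delta> by (simp add: e'_def)
    then obtain U :: "nat \<Rightarrow> 'a set" where U: "A \<subseteq> (\<Union>i. U i)" "\<And>i. bounded (U i)"
      "(\<Sum>i. ennreal (diameter (U i) powr s)) \<le> ennreal e'"
      using cover[OF \<open>e' > 0\<close>] by blast
    have "diameter (U i) \<le> \<delta>" for i
    proof -
      have "ennreal (diameter (U i) powr s) \<le> (\<Sum>i. ennreal (diameter (U i) powr s))"
        by (rule order_trans[OF _ sum_le_suminf[OF summableI, of "{i}"]]) auto
      also have "\<dots> \<le> ennreal (\<delta> powr s)"
        by (rule order_trans[OF U(3)]) (simp add: e'_def ennreal_leI)
      finally have "diameter (U i) powr s \<le> \<delta> powr s"
        by (subst (asm) ennreal_le_iff) auto
      then show ?thesis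
        using \<delta> s powr_less_mono2[of s \<delta> "diameter (U i)"] by (meson not_le less_imp_le)
    qed
    then have "hausdorff_pre s \<delta> A \<le> (\<Sum>i. ennreal (diameter (U i) powr s))"
      unfolding hausdorff_pre_def using U by (intro INF_lower) auto
    also have "\<dots> \<le> ennreal e" by (rule order_trans[OF U(3)]) (simp add: e'_def ennreal_leI)
    finally show ?thesis by simp
  qed
  have "hausdorff_pre s \<delta> A \<le> 0" if "\<delta> > 0" for \<delta>
    by (rule ennreal_le_epsilon) (rule le[OF that])
  then show ?thesis unfolding hausdorff_measure_def by (simp add: SUP_eq_const greaterThan_non_empty)
qed

lemma hausdorff_measure_eq_0D:
  fixes A :: "'a::metric_space set"
  assumes "hausdorff_measure s A = 0" and "e > 0"
  obtains U :: "nat \<Rightarrow> 'a set" where "A \<subseteq> (\<Union>i. U i)" "\<And>i. bounded (U i)"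
    "(\<Sum>i. ennreal (diameter (U i) powr s)) \<le> ennreal e"
proof -
  have "hausdorff_pre s 1 A \<le> hausdorff_measure s A"
    unfolding hausdorff_measure_def by (rule SUP_upper) simp
  then have "hausdorff_pre s 1 A < ennreal e" using assms by simp
  then show thesis
    unfolding hausdorff_pre_def INF_less_iff using that by (auto intro: less_imp_le)
qed

text \<open>The n-th set receives the budget e / 2^(n+1), and the covers are merged through the
  pairing function.\<close>

lemma hausdorff_measure_UN_eq_0:
  fixes A :: "nat \<Rightarrow> 'a::metric_space set"
  assumes s: "s > 0" and A: "\<And>n. hausdorff_measure s (A n) = 0"
  shows "hausdorff_measure s (\<Union>n. A n) = 0"
proof (rule hausdorff_measure_eq_0I[OF s])
  fix e :: real assume e: "e > 0"
  have "\<exists>U. A n \<subseteq> (\<Union>i. U i) \<and> (\<forall>i::nat. bounded (U i)) \<and>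
      (\<Sum>i. ennreal (diameter (U i) powr s)) \<le> ennreal (e * (1/2) ^ Suc n)" for n
    by (rule hausdorff_measure_eq_0D[OF A[of n], of "e * (1/2) ^ Suc n"]) (use e in simp, blast)
  then obtain U where U: "\<And>n. A n \<subseteq> (\<Union>i. U n i)" "\<And>n i::nat. bounded (U n i)"
      "\<And>n. (\<Sum>i. ennreal (diameter (U n i) powr s)) \<le> ennreal (e * (1/2) ^ Suc n)"
    by metis
  define V where "V k = (case prod_decode k of (n, i) \<Rightarrow> U n i)" for k
  have "(\<Union>n. A n) \<subseteq> (\<Union>k. V k)"
  proof
    fix x assume "x \<in> (\<Union>n. A n)"
    then obtain n i where "x \<in> U n i" using U(1) by blast
    then have "x \<in> V (prod_encode (n, i))" by (simp add: V_def)
    then show "x \<in> (\<Union>k. V k)" by blast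
  qed
  moreover have "bounded (V k)" for k using U(2) by (simp add: V_def split: prod.split)
  moreover have "(\<Sum>k. ennreal (diameter (V k) powr s)) \<le> ennreal e"
  proof -
    have "(\<Sum>k. ennreal (diameter (V k) powr s))
        = (\<Sum>k. (\<lambda>(n, i). ennreal (diameter (U n i) powr s)) (prod_decode k))"
      by (intro suminf_cong) (simp add: V_def split: prod.split)
    also have "\<dots> = (\<Sum>n. \<Sum>i. ennreal (diameter (U n i) powr s))"
      by (rule suminf_ennreal_2dimen) simp
    also have "\<dots> \<le> (\<Sum>n. ennreal (e * (1/2) ^ Suc n))"
      using U(3) by (intro suminf_le) auto
    also have "\<dots> = ennreal (e * 1)"
      using e sums_mult[OF power_half_series, of e] by (intro suminf_ennreal_eq) auto
    finally show ?thesis by simp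
  qed
  ultimately show "\<exists>U. (\<Union>n. A n) \<subseteq> (\<Union>i. U i) \<and> (\<forall>i. bounded (U i)) \<and>
      (\<Sum>i. ennreal (diameter (U i) powr s)) \<le> ennreal e" by blast
qed

lemma hausdorff_measure_Un_eq_0:
  assumes "s > 0" "hausdorff_measure s A = 0" "hausdorff_measure s B = 0"
  shows "hausdorff_measure s (A \<union> B) = 0"
proof (rule hausdorff_measure_eq_0_mono)
  let ?F = "\<lambda>n::nat. if n = 0 then A else B"
  have "A = ?F 0" "B = ?F 1" by auto
  then show "A \<union> B \<subseteq> (\<Union>n. ?F n)" by blast
  show "hausdorff_measure s (\<Union>n. ?F n) = 0"
    using assms by (intro hausdorff_measure_UN_eq_0) auto
qed

lemma hausdorff_measure_countable_eq_0:
  assumes "s > 0" "countable A"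
  shows "hausdorff_measure s A = 0"
proof (rule hausdorff_measure_eq_0I[OF assms(1)])
  fix e :: real assume "e > 0"
  \<comment> \<open>Singletons have diameter 0, and \<open>0 powr s\<close> is 0.\<close>
  have "A \<subseteq> (\<Union>i. {from_nat_into A i})"
    using from_nat_into_surj[OF assms(2)] by blast
  then show "\<exists>U. A \<subseteq> (\<Union>i. U i) \<and> (\<forall>i. bounded (U i)) \<and>
      (\<Sum>i. ennreal (diameter (U i) powr s)) \<le> ennreal e"
    by (intro exI[of _ "\<lambda>i. {from_nat_into A i}"]) auto
qed

text \<open>The Borel-Cantelli covering argument: each point lies in pieces with arbitrarily large
  q, so the pieces with q \<ge> N cover \<open>A\<close> for every N, while their total is a tail of
  a convergent series.\<close>

lemma hausdorff_measure_limsup_eq_0: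
  fixes V :: "nat \<Rightarrow> nat \<Rightarrow> 'a::metric_space set" and m :: "nat \<Rightarrow> nat" and \<rho> :: "nat \<Rightarrow> real"
  assumes s: "s > 0"
    and A: "\<And>a n. a \<in> A \<Longrightarrow> \<exists>q\<ge>n. \<exists>j<m q. a \<in> V q j"
    and V: "\<And>q j. bounded (V q j)" "\<And>q j. diameter (V q j) \<le> \<rho> q"
    and summ: "summable (\<lambda>q. real (m q) * \<rho> q powr s)"
  shows "hausdorff_measure s A = 0"
proof (rule hausdorff_measure_eq_0I[OF s])
  fix e :: real assume e: "e > 0"
  define w where "w q = real (m q) * \<rho> q powr s" for q
  have w: "w q \<ge> 0" for q by (simp add: w_def)
  have sw: "summable w" using summ by (simp add: w_def[abs_def])
  obtain N where "norm (\<Sum>i. w (i + N)) < e"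
    using suminf_exist_split[OF e sw] by blast
  then have N: "(\<Sum>i. w (i + N)) \<le> e" by simp
  \<comment> \<open>Surplus indices are filled with the empty set, which adds nothing to the
    sum.\<close>
  define U where "U k = (case prod_decode k of (i, j) \<Rightarrow> if j < m (i + N) then V (i + N) j else {})" for k
  have "A \<subseteq> (\<Union>k. U k)"
  proof
    fix a assume "a \<in> A"
    then obtain q j where "q \<ge> N" "j < m q" "a \<in> V q j" using A by blast
    then have "a \<in> U (prod_encode (q - N, j))" by (simp add: U_def)
    then show "a \<in> (\<Union>k. U k)" by blast
  qed
  moreover have "bounded (U k)" for k using V(1) by (simp add: U_def split: prod.split)
  moreover have "(\<Sum>k. ennreal (diameter (U k) powr s)) \<le> ennreal e"
  proof -
    let ?f = "\<lambda>(i, j). ennreal (diameter (if j < m (i + N) then V (i + N) j else {}) powr s)"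
    have "(\<Sum>k. ennreal (diameter (U k) powr s)) = (\<Sum>k. ?f (prod_decode k))"
      by (intro suminf_cong) (simp add: U_def split: prod.split)
    also have "\<dots> = (\<Sum>i. \<Sum>j. ?f (i, j))" by (rule suminf_ennreal_2dimen) simp
    also have "\<dots> \<le> (\<Sum>i. ennreal (w (i + N)))"
    proof (intro suminf_le)
      fix i
      have "(\<Sum>j. ?f (i, j)) = (\<Sum>j<m (i + N). ?f (i, j))"
        by (rule suminf_finite) auto
      also have "\<dots> \<le> (\<Sum>j<m (i + N). ennreal (\<rho> (i + N) powr s))"
        using s by (intro sum_mono) (auto intro!: ennreal_leI powr_mono2 V(2) diameter_ge_0 V(1))
      also have "\<dots> = ennreal (w (i + N))"
        by (simp add: w_def ennreal_mult ennreal_of_nat_eq_real_of_nat)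
      finally show "(\<Sum>j. ?f (i, j)) \<le> ennreal (w (i + N))" .
    qed auto
    also have "\<dots> = ennreal (\<Sum>i. w (i + N))"
      using w sw by (intro suminf_ennreal2) (auto simp: summable_iff_shift)
    also have "\<dots> \<le> ennreal e" using N by (rule ennreal_leI)
    finally show ?thesis .
  qed
  ultimately show "\<exists>U. A \<subseteq> (\<Union>i. U i) \<and> (\<forall>i. bounded (U i)) \<and>
      (\<Sum>i. ennreal (diameter (U i) powr s)) \<le> ennreal e" by blast
qed

section \<open>Well approximable numbers and Hoelder exponents\<close>

text \<open>Reduced fractions with unbounded denominators make this a limsup set, ready for covering
  by tails. For \<mu> > 1 it contains no rational, so rationals are treated apart.\<close>

definition well_approximable :: "real \<Rightarrow> real set" where
  "well_approximable \<mu> = {x. \<forall>n. \<exists>q\<ge>n. \<exists>p. q > 0 \<and> coprime p (int q) \<and>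
     \<bar>x - of_int p / real q\<bar> < real q powr (- \<mu>)}"

lemma diameter_image_le:
  fixes f :: "'a \<Rightarrow> 'b::real_normed_vector"
  assumes "\<And>x. x \<in> S \<Longrightarrow> dist (f x) a \<le> r" "0 \<le> r"
  shows "bounded (f ` S)" "diameter (f ` S) \<le> 2 * r"
proof -
  show "bounded (f ` S)"
    unfolding bounded_def using assms(1) by (auto simp: dist_commute intro!: exI[of _ a])
  show "diameter (f ` S) \<le> 2 * r"
  proof (rule diameter_le)
    show "f ` S \<noteq> {} \<or> 0 \<le> 2 * r" using assms by auto
    fix x y assume "x \<in> f ` S" "y \<in> f ` S"
    then have "dist x a \<le> r" "dist y a \<le> r" using assms(1) by auto
    then show "norm (x - y) \<le> 2 * r"
      using dist_triangle2[of x y a] by (simp add: dist_norm)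
  qed
qed

text \<open>A ball of radius q^(-\<mu>) about p/q has an image of size about
  q^(\<epsilon>-(\<mu>+1)/2), and a bounded interval meets on the order of q such balls. The
  resulting series has exponent 1 - s (\<mu> + 1)/2 + \<epsilon> s, below -1 for small
  \<epsilon>.\<close>

lemma hausdorff_measure_phi_well_approximable:
  fixes \<mu> s :: real
  assumes mu: "\<mu> \<ge> 2" and s: "s > 0" "s * (\<mu> + 1) > 4"
  shows "hausdorff_measure s ((\<lambda>x. phi (- x / (2 * pi))) ` well_approximable \<mu>) = 0"
proof -
  \<comment> \<open>This choice makes the exponent of the covering series equal to -s (\<mu> +
    1)/4.\<close>
  define \<epsilon> where "\<epsilon> = (s * (\<mu> + 1) - 4) / (4 * s)"
  have eps: "\<epsilon> > 0" using s by (simp add: \<epsilon>_def)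
  define g where "g x = phi (- x / (2 * pi))" for x
  obtain C where C: "C > 0"
    "\<And>p q x h. coprime p (int q) \<Longrightarrow> q > 0 \<Longrightarrow> \<bar>x - of_int p / real q\<bar> \<le> 1 / (real q)\<^sup>2 \<Longrightarrow>
       \<bar>h\<bar> \<le> 1 / (real q)\<^sup>2 \<Longrightarrow>
       norm (phi (- (x + h) / (2 * pi)) - phi (- x / (2 * pi))) \<le> C * real q powr (\<epsilon> - 1/2) * sqrt \<bar>h\<bar>"
    using norm_phi_diff_le_of_rational_approx[OF eps] by blast
  define r where "r q = C * real q powr (\<epsilon> - 1/2 - \<mu> / 2)" for q
  have r: "r q \<ge> 0" for q using C by (simp add: r_def)
  have near: "dist (g x) (g (of_int p / real q)) \<le> r q"
    if pq: "coprime p (int q)" "q > 0" and x: "\<bar>x - of_int p / real q\<bar> < real q powr (- \<mu>)" for x p q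
  proof -
    define h where "h = x - of_int p / real q"
    have hx: "x = of_int p / real q + h" by (simp add: h_def)
    have h: "\<bar>h\<bar> \<le> real q powr (- \<mu>)" using x by (simp add: h_def)
    also have "\<dots> \<le> real q powr (- 2)" using pq mu by (intro powr_mono) auto
    also have "\<dots> = 1 / (real q)\<^sup>2" using pq by (simp add: powr_minus_divide)
    finally have h2: "\<bar>h\<bar> \<le> 1 / (real q)\<^sup>2" .
    have "dist (g x) (g (of_int p / real q)) \<le> C * real q powr (\<epsilon> - 1/2) * sqrt \<bar>h\<bar>"
      unfolding dist_norm g_def hx using C(2)[OF pq _ h2, of "of_int p / real q"] by simp
    also have "\<dots> \<le> C * real q powr (\<epsilon> - 1/2) * sqrt (real q powr (- \<mu>))"
      using C(1) h by (intro mult_left_mono real_sqrt_le_mono) auto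
    also have "sqrt (real q powr (- \<mu>)) = real q powr (- \<mu> / 2)"
      by (simp add: powr_half_sqrt[symmetric] powr_powr)
    also have "C * real q powr (\<epsilon> - 1/2) * real q powr (- \<mu> / 2) = r q"
      by (simp add: r_def powr_add[symmetric] mult.assoc)
    finally show ?thesis .
  qed
  have "hausdorff_measure s (g ` (well_approximable \<mu> \<inter> {- real M..real M})) = 0" for M :: nat
  proof (rule hausdorff_measure_limsup_eq_0[OF s(1)])
    \<comment> \<open>For |x| \<le> M and radius at most 1 the numerators satisfy |p| \<le> (M + 1)
      q; \<open>ctr\<close> enumerates them as integers centred at 0.\<close>
    define m where "m q = 2 * (M + 1) * q + 1" for q
    define ctr where "ctr q j = int j - int ((M + 1) * q)" for q j :: nat
    \<comment> \<open>The conditions on q and the numerator sit inside the set, so inadmissible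
      indices give the empty piece and the diameter bound holds throughout.\<close>
    define V where "V q j = g ` {x. q > 0 \<and> coprime (ctr q j) (int q) \<and>
      \<bar>x - of_int (ctr q j) / real q\<bar> < real q powr (- \<mu>)}" for q j
    show "\<exists>q\<ge>n. \<exists>j<m q. a \<in> V q j" if a: "a \<in> g ` (well_approximable \<mu> \<inter> {- real M..real M})" for a n
    proof -
      obtain x where x: "a = g x" "x \<in> well_approximable \<mu>" "\<bar>x\<bar> \<le> real M" using a by auto
      then obtain q p where q: "q \<ge> n" "q > 0" "coprime p (int q)" "\<bar>x - of_int p / real q\<bar> < real q powr (- \<mu>)"
        unfolding well_approximable_def by blast
      have "real q powr (- \<mu>) \<le> real q powr 0" using q mu by (intro powr_mono) auto
      then have "\<bar>of_int p / real q\<bar> \<le> real M + 1" using q x(3) by simp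
      then have "\<bar>real_of_int p\<bar> \<le> (real M + 1) * real q"
        using q(2) by (simp add: abs_divide pos_divide_le_eq)
      then have "\<bar>real_of_int p\<bar> \<le> real_of_int (int ((M + 1) * q))" by (simp add: algebra_simps)
      then have p: "\<bar>p\<bar> \<le> int ((M + 1) * q)" by linarith
      define j where "j = nat (p + int ((M + 1) * q))"
      have "int j = p + int ((M + 1) * q)" using p unfolding j_def by linarith
      then have j: "ctr q j = p" "j < m q" using p unfolding ctr_def m_def by linarith+
      have "a \<in> V q j" unfolding V_def j(1) using q x(1) by blast
      then show ?thesis using q(1) j(2) by blast
    qed
    have "bounded (V q j) \<and> diameter (V q j) \<le> 2 * r q" for q j
      unfolding V_def
      using diameter_image_le[of "{x. q > 0 \<and> coprime (ctr q j) (int q) \<and>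
        \<bar>x - of_int (ctr q j) / real q\<bar> < real q powr (- \<mu>)}" g "g (of_int (ctr q j) / real q)" "r q"] near r
      by blast
    then show "bounded (V q j)" "diameter (V q j) \<le> 2 * r q" for q j by auto
    let ?K = "(2 * real M + 3) * (2 * C) powr s"
    let ?e = "1 + (\<epsilon> - 1/2 - \<mu> / 2) * s"
    show "summable (\<lambda>q. real (m q) * (2 * r q) powr s)"
    proof (rule summable_comparison_test')
      define w where "w = s * (\<mu> + 1)"
      have "\<epsilon> * s = (w - 4) / 4" using s by (simp add: \<epsilon>_def w_def)
      moreover have "?e = 1 + \<epsilon> * s - w / 2" by (simp add: w_def field_simps)
      ultimately have "?e = - w / 4" by (simp only:) (simp add: field_simps)
      then have "?e < -1" using s(2) by (simp add: w_def)
      then show "summable (\<lambda>q. ?K * real q powr ?e)"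
        by (intro summable_mult summable_real_powr_iff[THEN iffD2])
      fix q :: nat assume q: "q \<ge> 1"
      have "real (m q) * (2 * r q) powr s
          = real (m q) * ((2 * C) powr s * real q powr ((\<epsilon> - 1/2 - \<mu> / 2) * s))"
        using C by (simp add: r_def powr_mult powr_powr)
      also have "\<dots> \<le> ((2 * real M + 3) * real q) * ((2 * C) powr s * real q powr ((\<epsilon> - 1/2 - \<mu> / 2) * s))"
        using q by (intro mult_right_mono) (auto simp: m_def algebra_simps)
      also have "\<dots> = ?K * (real q powr 1 * real q powr ((\<epsilon> - 1/2 - \<mu> / 2) * s))"
        using q by simp
      also have "\<dots> = ?K * real q powr ?e" by (simp only: powr_add)
      finally show "norm (real (m q) * (2 * r q) powr s) \<le> ?K * real q powr ?e" by simp
    qed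
  qed
  then have "hausdorff_measure s (\<Union>M. g ` (well_approximable \<mu> \<inter> {- real M..real M})) = 0"
    by (intro hausdorff_measure_UN_eq_0 s)
  moreover have "g ` well_approximable \<mu> \<subseteq> (\<Union>M. g ` (well_approximable \<mu> \<inter> {- real M..real M}))"
  proof
    fix a assume "a \<in> g ` well_approximable \<mu>"
    then obtain x where x: "a = g x" "x \<in> well_approximable \<mu>" by auto
    obtain M :: nat where "\<bar>x\<bar> \<le> real M" using real_arch_simple by blast
    then have "x \<in> {- real M..real M}" by auto
    then show "a \<in> (\<Union>M. g ` (well_approximable \<mu> \<inter> {- real M..real M}))" using x by blast
  qed
  ultimately show ?thesis unfolding g_def[abs_def] using hausdorff_measure_eq_0_mono by blast
qed

section \<open>Hoelder regularity off the well approximable numbers\<close>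

lemma irrational_diophantine:
  fixes x \<mu> :: real
  assumes irr: "x \<notin> \<rat>" and x: "x \<notin> well_approximable \<mu>" and mu: "\<mu> > 0"
  obtains c where "c > 0"
    "\<And>p q. coprime p (int q) \<Longrightarrow> q > 0 \<Longrightarrow> c * real q powr (- \<mu>) \<le> \<bar>x - of_int p / real q\<bar>"
proof -
  obtain n where n: "\<And>q p. q \<ge> n \<Longrightarrow> q > 0 \<Longrightarrow> coprime p (int q) \<Longrightarrow>
      real q powr (- \<mu>) \<le> \<bar>x - of_int p / real q\<bar>"
    using x unfolding well_approximable_def by (auto simp: not_less)
  define f where "f q = \<bar>real q * x - of_int (round (real q * x))\<bar> / real q" for q :: nat
  \<comment> \<open>From n on the constant 1 works; the finitely many smaller denominators have
    positive distance by irrationality, and the minimum serves all.\<close>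
  define c where "c = Min (insert 1 (f ` {1..n}))"
  have f_pos: "f q > 0" if "q > 0" for q
  proof -
    have "real q * x \<noteq> of_int (round (real q * x))"
    proof
      assume "real q * x = of_int (round (real q * x))"
      then have "x = of_int (round (real q * x)) / real q" using that by (simp add: field_simps)
      also have "\<dots> \<in> \<rat>" by simp
      finally show False using irr by simp
    qed
    then show ?thesis using that by (simp add: f_def)
  qed
  have f_le: "f q \<le> \<bar>x - of_int p / real q\<bar>" if "q > 0" for p q
  proof -
    have "f q \<le> \<bar>real q * x - of_int p\<bar> / real q"
      unfolding f_def by (intro divide_right_mono round_diff_minimal) auto
    also have "\<dots> = \<bar>x - of_int p / real q\<bar>"
      using that by (subst abs_div_pos) (auto simp: field_simps)
    finally show ?thesis .
  qed
  have c: "c > 0" "c \<le> 1" "\<And>q. q \<in> {1..n} \<Longrightarrow> c \<le> f q"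
    unfolding c_def using f_pos by (auto simp del: Min_insert intro: Min_le)
  show thesis
  proof (rule that[OF c(1)])
    fix p :: int and q :: nat assume pq: "coprime p (int q)" "q > 0"
    show "c * real q powr (- \<mu>) \<le> \<bar>x - of_int p / real q\<bar>"
    proof (cases "q \<ge> n")
      case True
      have "c * real q powr (- \<mu>) \<le> 1 * real q powr (- \<mu>)" using c by (intro mult_right_mono) auto
      also have "\<dots> \<le> \<bar>x - of_int p / real q\<bar>" using n[OF True pq(2,1)] by simp
      finally show ?thesis .
    next
      case False
      have "real q powr (- \<mu>) \<le> real q powr 0" using pq mu by (intro powr_mono) auto
      then have "c * real q powr (- \<mu>) \<le> c * 1" using c pq by (intro mult_left_mono) auto
      also have "\<dots> \<le> f q" using c(3)[of q] False pq by simp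
      also have "\<dots> \<le> \<bar>x - of_int p / real q\<bar>" by (rule f_le[OF pq(2)])
      finally show ?thesis .
    qed
  qed
qed

lemma holder_exponent_phi_gt:
  fixes t \<mu> \<alpha> :: real
  assumes irr: "- 2 * pi * t \<notin> \<rat>" and t: "- 2 * pi * t \<notin> well_approximable \<mu>" and mu: "\<mu> > 1"
    and \<alpha>: "0 < \<alpha>" "\<alpha> < 1/2 + 1 / (2 * \<mu>)"
  shows "ereal \<alpha> < holder_exponent phi t"
proof -
  define x where "x = - 2 * pi * t"
  obtain c where c: "c > 0"
    "\<And>p q. coprime p (int q) \<Longrightarrow> q > 0 \<Longrightarrow> c * real q powr (- \<mu>) \<le> \<bar>x - of_int p / real q\<bar>"
    using irrational_diophantine[OF irr t] mu unfolding x_def by (metis less_trans zero_less_one)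
  \<comment> \<open>Giving up half the gap makes \<open>a\<close> the midpoint, so the final
    inequality stays strict.\<close>
  define \<epsilon> where "\<epsilon> = (1/2 + 1 / (2 * \<mu>) - \<alpha>) / 2"
  define a where "a = 1/2 + 1 / (2 * \<mu>) - \<epsilon>"
  have "1 / (2 * \<mu>) \<le> 1 / 2" using mu by (intro divide_left_mono) auto
  then have eps: "\<epsilon> > 0" "\<epsilon> \<le> 1" using \<alpha> by (auto simp: \<epsilon>_def)
  have a: "\<alpha> < a" "a > 0" using \<alpha> by (auto simp: a_def \<epsilon>_def field_simps)
  obtain C where C: "C > 0" "\<And>h. \<bar>h\<bar> \<le> 1 \<Longrightarrow>
      norm (phi (- (x + h) / (2 * pi)) - phi (- x / (2 * pi))) \<le> C * \<bar>h\<bar> powr a"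
    using norm_phi_diff_le_of_diophantine[OF c(1) mu eps c(2)] unfolding a_def by blast
  have "holder_at phi a t"
    unfolding holder_at_def
  \<comment> \<open>The constant polynomial has degree 0, hence at most \<open>a\<close>; the factor
    (2 pi)^a comes from the change of variable.\<close>
  proof (intro conjI exI[of _ "[:phi t:]"] exI[of _ "C * (2 * pi) powr a"])
    show "\<forall>\<^sub>F h in nhds 0. norm (phi (t + h) - poly [:phi t:] (complex_of_real h))
        \<le> C * (2 * pi) powr a * \<bar>h\<bar> powr a"
    proof (rule eventually_nhds_metric[THEN iffD2], intro exI[of _ "1 / (2 * pi)"] conjI allI impI)
      fix h :: real assume "dist h 0 < 1 / (2 * pi)"
      then have "\<bar>- 2 * pi * h\<bar> \<le> 1" by (simp add: abs_mult field_simps)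
      moreover have "- (x + - 2 * pi * h) / (2 * pi) = t + h" "- x / (2 * pi) = t"
        by (simp_all add: x_def field_simps)
      ultimately have "norm (phi (t + h) - phi t) \<le> C * \<bar>- 2 * pi * h\<bar> powr a"
        using C(2)[of "- 2 * pi * h"] by (simp only:)
      also have "\<bar>- 2 * pi * h\<bar> powr a = (2 * pi) powr a * \<bar>h\<bar> powr a"
        by (simp add: abs_mult powr_mult)
      finally show "norm (phi (t + h) - poly [:phi t:] (complex_of_real h))
          \<le> C * (2 * pi) powr a * \<bar>h\<bar> powr a" by simp
    qed simp
  qed (use a C in auto)
  then have "ereal a \<le> holder_exponent phi t"
    unfolding holder_exponent_def by (intro Sup_upper) auto
  then show ?thesis using a(1) by (metis ereal_less(1) less_ereal.simps(1) less_le_trans)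
qed

section \<open>Choice of the approximation exponent and conclusion\<close>

lemma irrational_well_approximable_2:
  assumes "x \<notin> \<rat>"
  shows "x \<in> well_approximable 2"
  unfolding well_approximable_def
proof (intro CollectI allI)
  fix n :: nat
  have "infinite (approx_set x)" using assms rational_iff_finite_approx_set by blast
  then obtain h k where hk: "(h, k) \<in> approx_set x" "k > int n"
    using infinite_approx_set by blast
  then have "k > 0" "coprime h k" "\<bar>x - of_int h / of_int k\<bar> < 1 / (of_int k)\<^sup>2"
    by (auto simp: approx_set_def)
  moreover from this have "real_of_int k powr (- 2) = 1 / (of_int k)\<^sup>2"
    by (simp add: powr_minus_divide)
  ultimately show "\<exists>q\<ge>n. \<exists>p. q > 0 \<and> coprime p (int q) \<and>
      \<bar>x - of_int p / real q\<bar> < real q powr (- 2)"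
    using hk(2) by (intro exI[of _ "nat k"] conjI exI[of _ h]) auto
qed

text \<open>Covering requires \<mu> > 4/s - 1 and regularity requires \<mu> < 1/(2\<alpha> - 1); for
  \<alpha> > 1/2 these are compatible exactly when s > (4\<alpha> - 2)/\<alpha>. At \<alpha> = 1/2
  the upper limit disappears; at \<alpha> = 3/4 it equals 2, and \<mu> = 2 is taken as a separate
  alternative.\<close>

lemma exists_approximation_exponent:
  fixes \<alpha> s :: real
  assumes \<alpha>: "1/2 \<le> \<alpha>" "\<alpha> \<le> 3/4" and s: "s > 0" "s > (4 * \<alpha> - 2) / \<alpha>"
  obtains \<mu> where "\<mu> \<ge> 2" "s * (\<mu> + 1) > 4" "\<alpha> < 1/2 + 1 / (2 * \<mu>) \<or> \<mu> = 2"
proof -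
  have s': "2 * (2 * \<alpha> - 1) < s * \<alpha>" using s(2) \<alpha> by (simp add: field_simps)
  consider "\<alpha> = 3/4" | "\<alpha> = 1/2" | "1/2 < \<alpha>" "\<alpha> < 3/4" using \<alpha> by linarith
  then show thesis
  proof cases
    case 1
    have "s * (2 + 1) > 4" using s' unfolding 1 by simp
    then show thesis by (intro that[of 2]) auto
  next
    case 2
    have "4 \<le> s * max 2 (4 / s)" using s(1) by (simp add: max_def field_simps)
    then show thesis using 2 s(1) by (intro that[of "max 2 (4 / s)"]) (auto simp: distrib_left)
  next
    case 3
    have "4 / s - 1 < 1 / (2 * \<alpha> - 1)" using s(1) s' 3 by (simp add: field_simps)
    moreover have "2 < 1 / (2 * \<alpha> - 1)" using 3 by (simp add: field_simps)
    ultimately obtain \<mu> where \<mu>: "2 < \<mu>" "4 / s - 1 < \<mu>" "\<mu> < 1 / (2 * \<alpha> - 1)"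
      using dense[of "max 2 (4 / s - 1)" "1 / (2 * \<alpha> - 1)"] by auto
    show thesis
    proof (rule that)
      show "s * (\<mu> + 1) > 4" using \<mu>(2) s(1) by (simp add: field_simps)
      have "\<mu> * (2 * \<alpha> - 1) < 1" using \<mu>(3) 3 by (simp add: field_simps)
      then show "\<alpha> < 1/2 + 1 / (2 * \<mu>) \<or> \<mu> = 2" using \<mu>(1) by (simp add: field_simps)
    qed (use \<mu> in simp)
  qed
qed

theorem theorem2:
  fixes \<alpha> :: real
  assumes "1/2 \<le> \<alpha>" and "\<alpha> \<le> 3/4"
  shows "hausdorff_dim (phi ` D_set \<alpha>) \<le> hausdorff_dim (\<Union>\<beta>\<in>{\<beta>. \<beta> \<le> \<alpha>}. phi ` D_set \<beta>)
       \<and> hausdorff_dim (\<Union>\<beta>\<in>{\<beta>. \<beta> \<le> \<alpha>}. phi ` D_set \<beta>) \<le> ereal ((4 * \<alpha> - 2) / \<alpha>)"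
proof (intro conjI hausdorff_dim_mono hausdorff_dim_le)
  show "phi ` D_set \<alpha> \<subseteq> (\<Union>\<beta>\<in>{\<beta>. \<beta> \<le> \<alpha>}. phi ` D_set \<beta>)" by blast
  show "0 \<le> (4 * \<alpha> - 2) / \<alpha>" using assms by simp
  fix s :: real assume s: "s > (4 * \<alpha> - 2) / \<alpha>" "s > 0"
  obtain \<mu> where \<mu>: "\<mu> \<ge> 2" "s * (\<mu> + 1) > 4" "\<alpha> < 1/2 + 1 / (2 * \<mu>) \<or> \<mu> = 2"
    using exists_approximation_exponent[OF assms s(2,1)] by blast
  let ?g = "\<lambda>x. phi (- x / (2 * pi))"
  have "(\<Union>\<beta>\<in>{\<beta>. \<beta> \<le> \<alpha>}. phi ` D_set \<beta>) \<subseteq> ?g ` well_approximable \<mu> \<union> ?g ` \<rat>"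
  proof
    fix z assume "z \<in> (\<Union>\<beta>\<in>{\<beta>. \<beta> \<le> \<alpha>}. phi ` D_set \<beta>)"
    then obtain \<beta> t where t: "\<beta> \<le> \<alpha>" "holder_exponent phi t = ereal \<beta>" "z = phi t"
      by (auto simp: D_set_def)
    have "- 2 * pi * t \<in> well_approximable \<mu> \<union> \<rat>"
    proof (rule ccontr)
      assume "- 2 * pi * t \<notin> well_approximable \<mu> \<union> \<rat>"
      then have not: "- 2 * pi * t \<notin> well_approximable \<mu>" "- 2 * pi * t \<notin> \<rat>" by auto
      \<comment> \<open>The alternative \<mu> = 2 cannot occur here, as every irrational lies in
        \<open>well_approximable 2\<close>; this settles the endpoint \<alpha> = 3/4.\<close>
      then have "\<alpha> < 1/2 + 1 / (2 * \<mu>)" using \<mu>(3) irrational_well_approximable_2 by blast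
      then have "ereal \<alpha> < ereal \<beta>"
        using holder_exponent_phi_gt[OF not(2,1)] \<mu>(1) assms(1) t(2) by simp
      then show False using t(1) by simp
    qed
    moreover have "z = ?g (- 2 * pi * t)" by (simp add: t(3))
    ultimately show "z \<in> ?g ` well_approximable \<mu> \<union> ?g ` \<rat>" by blast
  qed
  moreover have "hausdorff_measure s (?g ` well_approximable \<mu> \<union> ?g ` \<rat>) = 0"
    using s(2) \<mu> by (intro hausdorff_measure_Un_eq_0 hausdorff_measure_phi_well_approximable
        hausdorff_measure_countable_eq_0 countable_image countable_rat)
  ultimately show "hausdorff_measure s (\<Union>\<beta>\<in>{\<beta>. \<beta> \<le> \<alpha>}. phi ` D_set \<beta>) = 0"
    by (rule hausdorff_measure_eq_0_mono)
qed

end
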